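(* Let $k$ be an algebraically closed field of characteristic $p\ge 0$. Let $X$ be a non-zero vector field on $\mathbb{P}^n_k$ of degree $m$. Let $V\subseteq\mathbb{P}^n_k$ be a hypersurface of degree $d$. If $V$ is smooth, left invariant by $X$, and $p\nmid d$, then $d\leq m+1$.
   Context: Vector fields: for an integer $m\ge 0$, a vector field of degree $m$ on $\mathbb{P}^n_k$ is a map of sheaves $X:\Omega^1_{\mathbb{P}^n_k}\to\mathcal{O}_{\mathbb{P}^n_k}(m-1)$. By the Euler sequence, it is induced by a homogeneous vector field $\sum_{i=0}^n G_i\partial_i$ on $\mathbb{A}^{n+1}_k$, with $G_i\in k[t_0,\dots,t_n]$ homogeneous of degree $m$ and $\partial_i=\partial/\partial t_i$; two such homogeneous fields induce the same $X$ if and only if they differ by a multiple $H\sum t_i\partial_i$ of the radial field. Invariance: a closed subscheme $V\subseteq\mathbb{P}^n_k$ is left invariant by $X$ if $X|_V$ factors through the natural surjection $\Omega^1_{\mathbb{P}^n_k}|_V\to\Omega^1_V$. For the hypersurface cut out by a homogeneous polynomial $F$ this means $\sum G_i\partial_iF=PF$ for some $P\in k[t_0,\dots,t_n]$. If $p=0$, the condition $p\nmid d$ always holds. *)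

theory Defs
  imports "HOL-Computational_Algebra.Computational_Algebra" "HOL-Library.Poly_Mapping"
begin

section \<open>Homogeneous polynomials in \<open>t\<^sub>0, \<dots>, t\<^sub>n\<close>\<close>

type_synonym 'k mpoly = "(nat \<Rightarrow>\<^sub>0 nat) \<Rightarrow>\<^sub>0 'k"

definition const_poly :: "'k::zero \<Rightarrow> 'k mpoly" where
  "const_poly c = Poly_Mapping.single 0 c"

definition monom_degree :: "(nat \<Rightarrow>\<^sub>0 nat) \<Rightarrow> nat" where
  "monom_degree s = (\<Sum>i\<in>Poly_Mapping.keys s. Poly_Mapping.lookup s i)"

text \<open>The degree \<open>e\<close> part of \<open>k[t\<^sub>0, \<dots>, t\<^sub>n]\<close>; it contains \<open>0\<close> for every \<open>e\<close>.\<close>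

definition homog :: "nat \<Rightarrow> nat \<Rightarrow> 'k::zero mpoly set" where
  "homog n e = {f. \<forall>s\<in>Poly_Mapping.keys f. Poly_Mapping.keys s \<subseteq> {..n} \<and> monom_degree s = e}"

definition eval_poly :: "(nat \<Rightarrow> 'k::comm_semiring_1) \<Rightarrow> 'k mpoly \<Rightarrow> 'k" where
  "eval_poly x f = (\<Sum>s\<in>Poly_Mapping.keys f. Poly_Mapping.lookup f s *
     (\<Prod>i\<in>Poly_Mapping.keys s. x i ^ Poly_Mapping.lookup s i))"

text \<open>Subtraction of exponents is truncated, which is harmless: a monomial not involving
  \<open>t\<^sub>i\<close> gets coefficient \<open>0\<close>.\<close>

definition partial_deriv :: "nat \<Rightarrow> 'k::comm_semiring_1 mpoly \<Rightarrow> 'k mpoly" where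
  "partial_deriv i f = (\<Sum>s\<in>Poly_Mapping.keys f.
     Poly_Mapping.single (s - Poly_Mapping.single i 1)
       (of_nat (Poly_Mapping.lookup s i) * Poly_Mapping.lookup f s))"

section \<open>The sheaves \<open>\<O>(l)\<close> on projective space\<close>

text \<open>
  All sheaves are described by their sections over the base of open sets
  \<open>D\<^sub>+(f) = {f \<noteq> 0}\<close>, with \<open>f\<close> non-zero homogeneous of positive degree. Since projective
  space is integral, sections of \<open>\<O>(l)\<close> are elements of the fraction field of the
  polynomial ring, and restriction maps are inclusions.
\<close>

definition basic_open :: "nat \<Rightarrow> 'k::zero mpoly \<Rightarrow> bool" where
  "basic_open n f \<longleftrightarrow> f \<noteq> 0 \<and> (\<exists>e>0. f \<in> homog n e)"

text \<open>\<open>\<O>(l)(D\<^sub>+(f))\<close>: the degree \<open>l\<close> part of the localisation \<open>k[t\<^sub>0, \<dots>, t\<^sub>n]\<^sub>f\<close>.\<close>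

definition twist_sections :: "nat \<Rightarrow> int \<Rightarrow> 'k::field mpoly \<Rightarrow> 'k mpoly fract set" where
  "twist_sections n l f =
     {Fract a (f ^ r) | a r. \<exists>e d. f \<in> homog n e \<and> a \<in> homog n d \<and> int d = l + int (r * e)}"

section \<open>Vector fields\<close>

text \<open>
  By the universal property of Kaehler differentials, a map of sheaves
  \<open>\<Omega>\<^sup>1 \<rightarrow> \<O>(m - 1)\<close> is a \<open>k\<close>-linear derivation \<open>\<O> \<rightarrow> \<O>(m - 1)\<close>, that is, a family of
  derivations \<open>\<O>(D\<^sub>+(f)) \<rightarrow> \<O>(m - 1)(D\<^sub>+(f))\<close> compatible with restrictions. As
  restrictions are inclusions, such a family is a single function; its values outside the
  sections of \<open>\<O>\<close> are irrelevant.
\<close>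

definition is_vector_field ::
  "nat \<Rightarrow> nat \<Rightarrow> ('k::field mpoly fract \<Rightarrow> 'k mpoly fract) \<Rightarrow> bool" where
  "is_vector_field n m X \<longleftrightarrow>
     (\<forall>f. basic_open n f \<longrightarrow>
        (\<forall>u\<in>twist_sections n 0 f. X u \<in> twist_sections n (int m - 1) f) \<and>
        (\<forall>u\<in>twist_sections n 0 f. \<forall>v\<in>twist_sections n 0 f. X (u + v) = X u + X v) \<and>
        (\<forall>c. \<forall>u\<in>twist_sections n 0 f.
           X (Fract (const_poly c) 1 * u) = Fract (const_poly c) 1 * X u) \<and>
        (\<forall>u\<in>twist_sections n 0 f. \<forall>v\<in>twist_sections n 0 f. X (u * v) = u * X v + v * X u))"

definition nonzero_vector_field ::
  "nat \<Rightarrow> ('k::field mpoly fract \<Rightarrow> 'k mpoly fract) \<Rightarrow> bool" where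
  "nonzero_vector_field n X \<longleftrightarrow> (\<exists>f. basic_open n f \<and> (\<exists>u\<in>twist_sections n 0 f. X u \<noteq> 0))"

section \<open>Hypersurfaces\<close>

text \<open>A hypersurface of degree \<open>d\<close>, possibly non-reduced, is given by its equation.\<close>

definition is_hypersurface :: "nat \<Rightarrow> nat \<Rightarrow> 'k::field mpoly \<Rightarrow> bool" where
  "is_hypersurface n d F \<longleftrightarrow> 0 < d \<and> F \<noteq> 0 \<and> F \<in> homog n d"

text \<open>Jacobian criterion at the closed points; over an algebraically closed field these are
  the \<open>k\<close>-rational points.\<close>

definition smooth_hypersurface :: "nat \<Rightarrow> 'k::field mpoly \<Rightarrow> bool" where
  "smooth_hypersurface n F \<longleftrightarrow>
     (\<forall>x. (\<exists>i\<le>n. x i \<noteq> 0) \<and> eval_poly x F = 0 \<longrightarrow>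
        (\<exists>i\<le>n. eval_poly x (partial_deriv i F) \<noteq> 0))"

text \<open>Sections over \<open>D\<^sub>+(f)\<close> of the twisted ideal sheaf \<open>\<I>\<^sub>V(l) = F \<cdot> \<O>(l - d)\<close>.\<close>

definition ideal_sections ::
  "nat \<Rightarrow> nat \<Rightarrow> 'k::field mpoly \<Rightarrow> int \<Rightarrow> 'k mpoly \<Rightarrow> 'k mpoly fract set" where
  "ideal_sections n d F l f = (\<lambda>u. Fract F 1 * u) ` twist_sections n (l - int d) f"

text \<open>
  The kernel of \<open>\<Omega>\<^sup>1|\<^sub>V \<rightarrow> \<Omega>\<^sup>1\<^sub>V\<close> is generated by the differentials of sections of
  \<open>\<I>\<^sub>V\<close>. So \<open>X|\<^sub>V : \<Omega>\<^sup>1|\<^sub>V \<rightarrow> \<O>\<^sub>V(m - 1)\<close> factors through \<open>\<Omega>\<^sup>1\<^sub>V\<close> iff the derivation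
  \<open>\<O> \<rightarrow> \<O>(m - 1)\<close> corresponding to \<open>X\<close> maps \<open>\<I>\<^sub>V\<close> to \<open>\<I>\<^sub>V(m - 1)\<close>.
\<close>

definition leaves_invariant ::
  "nat \<Rightarrow> nat \<Rightarrow> ('k::field mpoly fract \<Rightarrow> 'k mpoly fract) \<Rightarrow> nat \<Rightarrow> 'k mpoly \<Rightarrow> bool" where
  "leaves_invariant n m X d F \<longleftrightarrow>
     (\<forall>f. basic_open n f \<longrightarrow>
        (\<forall>u\<in>ideal_sections n d F 0 f. X u \<in> ideal_sections n d F (int m - 1) f))"

end

theory Submission
  imports Defs
begin

text \<open>
  Since \<open>d\<close> is invertible in \<open>k\<close>, subtracting a multiple of the radial field from any lift of
  \<open>X\<close> gives a unique homogeneous lift \<open>\<Sum> G\<^sub>i \<partial>\<^sub>i\<close> with \<open>\<Sum> G\<^sub>i \<partial>\<^sub>iF = 0\<close>; it is non-zero because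
  \<open>X\<close> is. By uniqueness it can be computed in every chart, so that its components are
  polynomials of degree \<open>m\<close>. By Euler's formula and smoothness, the \<open>n + 1\<close> forms \<open>\<partial>\<^sub>iF\<close> of degree
  \<open>d - 1\<close> have no common zero in projective space, so by the Nullstellensatz their ideal
  contains a power of each variable. Powers of the variables form a regular sequence of length
  \<open>n + 1\<close>, and hence the Koszul complex of the \<open>\<partial>\<^sub>iF\<close> is exact in positive degrees. Thus every
  \<open>G\<^sub>i\<close> lies in the ideal of the \<open>\<partial>\<^sub>iF\<close>, and a non-zero one has degree \<open>m \<ge> d - 1\<close>.

  The Nullstellensatz is proved with places: a place with values in \<open>k\<close> of the residue field of a
  maximal ideal containing the forms and \<open>t\<^sub>j - 1\<close> gives a common zero after dividing the
  coordinates by one of minimal valuation.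
\<close>

section \<open>The Koszul complex\<close>

text \<open>The polynomial type has infinitely many variables, so Zariski's lemma does not apply:
  the residue field of a maximal ideal may be transcendental over k. A place still takes values in
  k, at the price that some coordinates may have no finite value; homogeneity of the forms permits
  the rescaling that repairs this.

  No dimension theory enters the Koszul argument. Every element of the ideal of the
  \<open>F i\<close> acts as zero on Koszul homology, through an explicit homotopy, so any regular
  sequence in that ideal with as many members as there are generators gives exactness. Powers of the
  variables are convenient because their regularity is visible on monomials.

  A lift is determined only up to the radial field, and gluing arbitrary chartwise lifts would call
  for cohomology. Requiring that F be annihilated removes this freedom, so the local formulas agree
  on overlaps on the nose. Two charts then suffice to obtain polynomials: a fraction whose
  denominator can be taken a power of one variable and also a power of another has no
  denominator.\<close>

definition koszul_sign :: "nat \<Rightarrow> nat set \<Rightarrow> 'a::comm_ring_1" where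
  "koszul_sign i S = (-1) ^ card {j\<in>S. j < i}"

text \<open>A family \<open>w\<close> stands for the element of the exterior algebra on a basis
  indexed by \<open>N\<close> whose coefficient at the basis element of \<open>S\<close> is
  \<open>w S\<close>. This is contraction with \<open>F\<close>, read off coefficientwise; it lowers
  the degree by one.\<close>

definition koszul_diff ::
  "(nat \<Rightarrow> 'a::comm_ring_1) \<Rightarrow> nat set \<Rightarrow> (nat set \<Rightarrow> 'a) \<Rightarrow> nat set \<Rightarrow> 'a" where
  "koszul_diff F N w S = (\<Sum>i\<in>N - S. koszul_sign i S * F i * w (insert i S))"

text \<open>Exterior multiplication from the left by the degree one element with coefficients
  \<open>c\<close>, in the same encoding.\<close>

definition koszul_wedge ::
  "(nat \<Rightarrow> 'a::comm_ring_1) \<Rightarrow> (nat set \<Rightarrow> 'a) \<Rightarrow> nat set \<Rightarrow> 'a" where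
  "koszul_wedge c w S = (\<Sum>i\<in>S. koszul_sign i S * c i * w (S - {i}))"

lemma koszul_sign_square: "koszul_sign i S * koszul_sign i S = 1"
  by (simp add: koszul_sign_def flip: power_mult_distrib)

lemma koszul_sign_insert_self: "koszul_sign i (insert i S) = koszul_sign i S"
proof -
  have "{j \<in> insert i S. j < i} = {j \<in> S. j < i}"
    by auto
  then show ?thesis by (simp add: koszul_sign_def)
qed

lemma koszul_sign_insert:
  assumes "finite S" "i \<notin> S"
  shows "koszul_sign l (insert i S) = (if i < l then - koszul_sign l S else koszul_sign l S)"
proof (cases "i < l")
  case True
  then have "{j \<in> insert i S. j < l} = insert i {j \<in> S. j < l}"
    by auto
  with True assms show ?thesis by (simp add: koszul_sign_def)
next
  case False
  then have "{j \<in> insert i S. j < l} = {j \<in> S. j < l}"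
    by auto
  with False show ?thesis by (simp add: koszul_sign_def)
qed

text \<open>Adding two indices in either order produces opposite signs. The double sum is split into
  its two orderings, which cancel each other; showing that it equals its own negative would not do
  in characteristic 2.\<close>

lemma koszul_diff_diff:
  assumes N: "finite N" and S: "S \<subseteq> N"
  shows "koszul_diff F N (koszul_diff F N w) S = 0"
proof -
  define B where "B = N - S"
  have fin: "finite B" "finite S"
    using assms finite_subset by (auto simp: B_def)
  define g where "g i l = koszul_sign i S * koszul_sign l (insert i S) * F i * F l * w (insert l (insert i S))"
    for i l
  have anti: "g i l = - g l i" if "i \<in> B" "l \<in> B" "i \<noteq> l" for i l
    using that fin by (auto simp: g_def B_def koszul_sign_insert insert_commute algebra_simps)
  have "koszul_diff F N (koszul_diff F N w) S = (\<Sum>i\<in>B. \<Sum>l\<in>N - insert i S. g i l)"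
    unfolding koszul_diff_def B_def g_def by (simp add: sum_distrib_left algebra_simps)
  also have "\<dots> = (\<Sum>i\<in>B. (\<Sum>l\<in>{l\<in>B. i < l}. g i l) + (\<Sum>l\<in>{l\<in>B. l < i}. g i l))"
  proof (rule sum.cong)
    fix i assume "i \<in> B"
    have "N - insert i S = {l\<in>B. i < l} \<union> {l\<in>B. l < i}"
      by (auto simp: B_def)
    moreover have "{l\<in>B. i < l} \<inter> {l\<in>B. l < i} = {}"
      by auto
    ultimately show "(\<Sum>l\<in>N - insert i S. g i l) =
        (\<Sum>l\<in>{l\<in>B. i < l}. g i l) + (\<Sum>l\<in>{l\<in>B. l < i}. g i l)"
      using fin by (simp add: sum.union_disjoint)
  qed simp
  also have "\<dots> = (\<Sum>i\<in>B. \<Sum>l\<in>{l\<in>B. i < l}. g i l) + (\<Sum>i\<in>B. \<Sum>l\<in>{l\<in>B. l < i}. g i l)"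
    by (simp add: sum.distrib)
  also have "(\<Sum>i\<in>B. \<Sum>l\<in>{l\<in>B. l < i}. g i l) = (\<Sum>l\<in>B. \<Sum>i\<in>{i\<in>B. l < i}. g i l)"
    by (rule sum.swap_restrict[OF fin(1) fin(1)])
  also have "\<dots> = - (\<Sum>l\<in>B. \<Sum>i\<in>{i\<in>B. l < i}. g l i)"
    unfolding sum_negf[symmetric] by (intro sum.cong refl anti) auto
  finally show ?thesis by simp
qed

text \<open>The mixed terms \<open>h i l\<close>, with \<open>i\<close> outside and \<open>l\<close>
  inside \<open>S\<close>, occur once with each sign. What remains is
  \<open>c i * F i * w S\<close>, for \<open>i\<close> outside \<open>S\<close> from the first
  summand and for \<open>i\<close> inside \<open>S\<close> from the second.\<close>

lemma koszul_homotopy: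
  assumes N: "finite N" and S: "S \<subseteq> N"
  shows "koszul_diff F N (koszul_wedge c w) S + koszul_wedge c (koszul_diff F N w) S
    = (\<Sum>i\<in>N. c i * F i) * w S"
proof -
  have fin: "finite S"
    using assms finite_subset by auto
  define h where "h i l = koszul_sign l (S - {l}) * koszul_sign i (S - {l}) * F i * c l * w (insert i (S - {l}))"
    for i l
  have 1: "koszul_sign i S * F i * koszul_wedge c w (insert i S)
      = c i * F i * w S - (\<Sum>l\<in>S. h i l)" if "i \<in> N - S" for i
  proof -
    have "koszul_sign i S * F i * (koszul_sign l (insert i S) * c l * w (insert i S - {l})) = - h i l"
      if "l \<in> S" for l
    proof -
      define T where "T = S - {l}"
      have T: "S = insert l T" "finite T" "l \<notin> T" "i \<notin> T" "i \<noteq> l"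
        using fin \<open>i \<in> N - S\<close> that by (auto simp: T_def)
      have "koszul_sign l (insert i S) = (koszul_sign l (insert i T) :: 'a)"
        unfolding T(1) by (subst insert_commute) (rule koszul_sign_insert_self)
      moreover have "insert i S - {l} = insert i T"
        using T by auto
      ultimately show ?thesis
        unfolding h_def using T by (auto simp: koszul_sign_insert algebra_simps)
    qed
    moreover have "insert i S - {i} = S"
      using that by auto
    moreover have "koszul_wedge c w (insert i S) = koszul_sign i (insert i S) * c i * w (insert i S - {i})
        + (\<Sum>l\<in>S. koszul_sign l (insert i S) * c l * w (insert i S - {l}))"
      unfolding koszul_wedge_def using that fin by simp
    moreover have "koszul_sign i S * F i * (koszul_sign i S * c i * w S) = c i * F i * w S"
    proof -
      have "koszul_sign i S * F i * (koszul_sign i S * c i * w S)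
        = (koszul_sign i S * koszul_sign i S) * (c i * F i * w S)"
        by (simp only: ac_simps)
      then show ?thesis by (simp add: koszul_sign_square)
    qed
    ultimately show ?thesis
      by (simp add: distrib_left sum_distrib_left koszul_sign_insert_self sum_negf)
  qed
  have 2: "koszul_sign l S * c l * koszul_diff F N w (S - {l})
      = c l * F l * w S + (\<Sum>i\<in>N - S. h i l)" if "l \<in> S" for l
  proof -
    have "N - (S - {l}) = insert l (N - S)"
      using that S by auto
    then have "koszul_diff F N w (S - {l}) = koszul_sign l (S - {l}) * F l * w (insert l (S - {l}))
        + (\<Sum>i\<in>N - S. koszul_sign i (S - {l}) * F i * w (insert i (S - {l})))"
      unfolding koszul_diff_def using that N by simp
    moreover have "insert l (S - {l}) = S"
      using that by auto
    moreover have sg: "koszul_sign l S = (koszul_sign l (S - {l}) :: 'a)"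
      using koszul_sign_insert_self[of l "S - {l}"] \<open>insert l (S - {l}) = S\<close> by simp
    moreover have "koszul_sign l (S - {l}) * c l * (koszul_sign l (S - {l}) * F l * w S) = c l * F l * w S"
    proof -
      have "koszul_sign l (S - {l}) * c l * (koszul_sign l (S - {l}) * F l * w S)
        = (koszul_sign l (S - {l}) * koszul_sign l (S - {l})) * (c l * F l * w S)"
        by (simp only: ac_simps)
      then show ?thesis by (simp add: koszul_sign_square)
    qed
    ultimately show ?thesis
      by (simp add: distrib_left sum_distrib_left h_def mult_ac)
  qed
  have "koszul_diff F N (koszul_wedge c w) S + koszul_wedge c (koszul_diff F N w) S
    = (\<Sum>i\<in>N - S. c i * F i * w S - (\<Sum>l\<in>S. h i l)) + (\<Sum>l\<in>S. c l * F l * w S + (\<Sum>i\<in>N - S. h i l))"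
    unfolding koszul_diff_def[of F N "koszul_wedge c w"]
      koszul_wedge_def[of c "koszul_diff F N w"]
    using 1 2 by simp
  also have "\<dots> = (\<Sum>i\<in>N - S. c i * F i * w S) + (\<Sum>l\<in>S. c l * F l * w S)"
    unfolding sum.distrib sum_subtractf
    by (simp add: sum.swap[of "\<lambda>i l. h i l" S "N - S"])
  also have "\<dots> = (\<Sum>i\<in>N. c i * F i * w S)"
    using N S by (metis sum.subset_diff)
  finally show ?thesis by (simp add: sum_distrib_right)
qed

section \<open>Ideals, and exactness of the Koszul complex modulo a regular sequence\<close>

definition is_ideal :: "'a::comm_ring_1 set \<Rightarrow> bool" where
  "is_ideal I \<longleftrightarrow> 0 \<in> I \<and> (\<forall>x\<in>I. \<forall>y\<in>I. x + y \<in> I) \<and> (\<forall>r. \<forall>x\<in>I. r * x \<in> I)"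

lemma is_idealD:
  assumes "is_ideal I"
  shows "0 \<in> I" and "x \<in> I \<Longrightarrow> y \<in> I \<Longrightarrow> x + y \<in> I" and "x \<in> I \<Longrightarrow> r * x \<in> I"
    and "x \<in> I \<Longrightarrow> x * r \<in> I" and "x \<in> I \<Longrightarrow> y \<in> I \<Longrightarrow> x - y \<in> I"
proof -
  show "0 \<in> I" "x \<in> I \<Longrightarrow> y \<in> I \<Longrightarrow> x + y \<in> I" "x \<in> I \<Longrightarrow> r * x \<in> I" "x \<in> I \<Longrightarrow> x * r \<in> I"
    using assms by (auto simp: is_ideal_def mult.commute)
  assume "x \<in> I" "y \<in> I"
  then have "x + (-1) * y \<in> I"
    using assms unfolding is_ideal_def by blast
  then show "x - y \<in> I" by simp
qed

lemma is_ideal_sum: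
  assumes "is_ideal I" "\<And>i. i \<in> A \<Longrightarrow> f i \<in> I"
  shows "(\<Sum>i\<in>A. f i) \<in> I"
  using assms(2) by (induction A rule: infinite_finite_induct) (auto intro: is_idealD[OF assms(1)])

lemma koszul_diff_in_ideal:
  assumes "is_ideal I" "\<And>S. S \<subseteq> N \<Longrightarrow> w S \<in> I" "S \<subseteq> N"
  shows "koszul_diff F N w S \<in> I"
  unfolding koszul_diff_def using assms
  by (intro is_ideal_sum[OF assms(1)] is_idealD(3)[OF assms(1)]) auto

lemma koszul_wedge_in_ideal:
  assumes "is_ideal I" "\<And>S. S \<subseteq> N \<Longrightarrow> w S \<in> I" "S \<subseteq> N"
  shows "koszul_wedge c w S \<in> I"
  unfolding koszul_wedge_def using assms(3)
  by (intro is_ideal_sum[OF assms(1)] is_idealD(3)[OF assms(1)] assms(2)) auto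

text \<open>Here \<open>J r\<close> is to be read as the ideal of the first \<open>r\<close> members
  of the sequence \<open>a\<close>. Descending induction on \<open>r\<close>, with the degree of
  \<open>w\<close> tied to \<open>r\<close>: at the top no subset of \<open>N\<close> is large
  enough for \<open>w\<close> to be non-zero. In the step, multiplying \<open>w\<close> by
  \<open>c r\<close> raises the degree, and the homotopy shows that the boundary of the product is
  \<open>a r * w\<close> modulo \<open>J r\<close>, hence zero modulo \<open>J (Suc r)\<close>. The
  induction hypothesis applies to the product, and regularity finally cancels
  \<open>a r\<close>.\<close>

lemma koszul_exact_mod:
  fixes F :: "nat \<Rightarrow> 'a::comm_ring_1" and J :: "nat \<Rightarrow> 'a set"
  assumes N: "finite N"
    and J: "\<And>r. is_ideal (J r)"
    and J_Suc: "\<And>r f. f \<in> J (Suc r) \<longleftrightarrow> (\<exists>u. f - a r * u \<in> J r)"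
    and regular: "\<And>r f. r < card N \<Longrightarrow> a r * f \<in> J r \<Longrightarrow> f \<in> J r"
    and a: "\<And>r. r < card N \<Longrightarrow> a r = (\<Sum>i\<in>N. c r i * F i)"
    and r: "r \<le> card N"
    and w: "\<And>S. S \<subseteq> N \<Longrightarrow> card S \<noteq> Suc r \<Longrightarrow> w S = 0"
    and cycle: "\<And>S. S \<subseteq> N \<Longrightarrow> koszul_diff F N w S \<in> J r"
  shows "\<exists>v. \<forall>S\<subseteq>N. w S - koszul_diff F N v S \<in> J r"
  using r w cycle
proof (induction r arbitrary: w rule: inc_induct)
  case base
  have "w S = 0" if "S \<subseteq> N" for S
    using base.prems(1)[OF that] card_mono[OF N that] by simp
  then show ?case
    by (intro exI[of _ "\<lambda>_. 0"]) (simp add: koszul_diff_def is_idealD(1)[OF J])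
next
  case (step r)
  let ?w = "koszul_wedge (c r) w"
  have hom: "koszul_diff F N ?w S + koszul_wedge (c r) (koszul_diff F N w) S = a r * w S"
    if "S \<subseteq> N" for S
    using koszul_homotopy[OF N that] a[OF \<open>r < card N\<close>] by simp
  have wedge_J: "koszul_wedge (c r) (koszul_diff F N w) S \<in> J r" if "S \<subseteq> N" for S
    by (rule koszul_wedge_in_ideal[OF J step.prems(2) that])
  have "\<exists>v. \<forall>S\<subseteq>N. ?w S - koszul_diff F N v S \<in> J (Suc r)"
  proof (rule step.IH)
    fix S assume S: "S \<subseteq> N"
    then have "finite S"
      using N finite_subset by blast
    show "?w S = 0" if "card S \<noteq> Suc (Suc r)"
      unfolding koszul_wedge_def
    proof (intro sum.neutral ballI)
      fix i assume "i \<in> S"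
      then have "card (S - {i}) \<noteq> Suc r"
        using that \<open>finite S\<close> by (metis card_Suc_Diff1)
      with S have "w (S - {i}) = 0"
        by (intro step.prems(1)) auto
      then show "koszul_sign i S * c r i * w (S - {i}) = 0" by simp
    qed
    have "koszul_diff F N ?w S - a r * w S = 0 - koszul_wedge (c r) (koszul_diff F N w) S"
      using hom[OF S] by (simp add: algebra_simps)
    also have "\<dots> \<in> J r"
      by (intro is_idealD[OF J] wedge_J S)
    finally show "koszul_diff F N ?w S \<in> J (Suc r)"
      using J_Suc by blast
  qed
  then obtain v where v: "\<And>S. S \<subseteq> N \<Longrightarrow> ?w S - koszul_diff F N v S \<in> J (Suc r)"
    by blast
  then have "\<forall>S. \<exists>u. S \<subseteq> N \<longrightarrow> ?w S - koszul_diff F N v S - a r * u \<in> J r"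
    using J_Suc by blast
  then obtain u where u: "\<And>S. S \<subseteq> N \<Longrightarrow> ?w S - koszul_diff F N v S - a r * u S \<in> J r"
    by metis
  define g where "g S = ?w S - koszul_diff F N v S - a r * u S" for S
  have "w S - koszul_diff F N u S \<in> J r" if S: "S \<subseteq> N" for S
  proof (rule regular[OF \<open>r < card N\<close>])
    \<comment> \<open>Taking the boundary of the error term \<open>g\<close> removes
      \<open>v\<close>, and by the homotopy the first summand becomes \<open>a r * w S\<close>
      modulo \<open>J r\<close>.\<close>
    have "koszul_diff F N g S
      = koszul_diff F N ?w S - koszul_diff F N (koszul_diff F N v) S - a r * koszul_diff F N u S"
      unfolding g_def koszul_diff_def[of F N _ S]
      by (simp add: algebra_simps sum_subtractf sum.distrib sum_distrib_left)
    then have "a r * (w S - koszul_diff F N u S)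
      = koszul_wedge (c r) (koszul_diff F N w) S + koszul_diff F N g S"
      unfolding right_diff_distrib hom[OF S, symmetric] koszul_diff_diff[OF N S, of F v] by simp
    also have "\<dots> \<in> J r"
      using u S by (intro is_idealD(2)[OF J] wedge_J koszul_diff_in_ideal[OF J]) (auto simp: g_def)
    finally show "a r * (w S - koszul_diff F N u S) \<in> J r" .
  qed
  then show ?case by blast
qed

text \<open>A syzygy is a cycle of degree one, supported on singletons. As \<open>J 0\<close> is
  zero, it is an actual boundary, and the value of a boundary at \<open>{i}\<close> is a combination
  of the \<open>F j\<close> with \<open>j\<close> different from \<open>i\<close>.\<close>

lemma syzygy_in_ideal:
  fixes F :: "nat \<Rightarrow> 'a::comm_ring_1" and J :: "nat \<Rightarrow> 'a set"
  assumes N: "finite N"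
    and J: "\<And>r. is_ideal (J r)"
    and J_0: "J 0 = {0}"
    and J_Suc: "\<And>r f. f \<in> J (Suc r) \<longleftrightarrow> (\<exists>u. f - a r * u \<in> J r)"
    and regular: "\<And>r f. r < card N \<Longrightarrow> a r * f \<in> J r \<Longrightarrow> f \<in> J r"
    and a: "\<And>r. r < card N \<Longrightarrow> a r = (\<Sum>i\<in>N. c r i * F i)"
    and syzygy: "(\<Sum>i\<in>N. F i * G i) = 0"
    and i: "i \<in> N"
  shows "\<exists>u. G i = (\<Sum>j\<in>N. F j * u j)"
proof -
  define w where "w S = (if card S = 1 then G (the_elem S) else 0)" for S
  have cycle: "koszul_diff F N w S \<in> J 0" if "S \<subseteq> N" for S
  proof (cases "S = {}")
    case True
    then have "koszul_diff F N w S = (\<Sum>i\<in>N. F i * G i)"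
      by (simp add: koszul_diff_def koszul_sign_def w_def)
    then show ?thesis using syzygy J_0 by simp
  next
    case False
    have "card (insert i S) \<noteq> 1" if "i \<in> N - S" for i
      using that False \<open>S \<subseteq> N\<close> N finite_subset[OF \<open>S \<subseteq> N\<close> N] by simp
    then have "koszul_diff F N w S = 0"
      unfolding koszul_diff_def by (intro sum.neutral) (simp add: w_def)
    then show ?thesis using J_0 by simp
  qed
  have "\<exists>v. \<forall>S\<subseteq>N. w S - koszul_diff F N v S \<in> J 0"
    by (rule koszul_exact_mod[where a = a and c = c, OF N J J_Suc regular a _ _ cycle])
      (simp_all add: w_def)
  then obtain v where "w {i} = koszul_diff F N v {i}"
    using i J_0 by force
  then have "G i = (\<Sum>j\<in>N - {i}. F j * (koszul_sign j {i} * v (insert j {i})))"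
    by (simp add: w_def koszul_diff_def mult_ac)
  also have "\<dots> = (\<Sum>j\<in>N. F j * (if j = i then 0 else koszul_sign j {i} * v (insert j {i})))"
    using N by (intro sum.mono_neutral_cong_left) auto
  finally show ?thesis
    by (rule exI[of _ "\<lambda>j. if j = i then 0 else koszul_sign j {i} * v (insert j {i})"])
qed

section \<open>Places\<close>

lemma exists_maximal_ideal:
  fixes I :: "'a::comm_ring_1 set"
  assumes "is_ideal I" "1 \<notin> I"
  obtains M where "is_ideal M" "1 \<notin> M" "I \<subseteq> M" "\<And>x. x \<notin> M \<Longrightarrow> \<exists>y. x * y - 1 \<in> M"
proof -
  let ?A = "{M. is_ideal M \<and> 1 \<notin> M \<and> I \<subseteq> M}"
  have "\<exists>M\<in>?A. \<forall>X\<in>?A. M \<subseteq> X \<longrightarrow> X = M"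
  proof (rule subset_Zorn_nonempty)
    show "?A \<noteq> {}" using assms by blast
    fix C assume C: "C \<noteq> {}" "subset.chain ?A C"
    then have sub: "C \<subseteq> ?A" and lin: "\<And>X Y. X \<in> C \<Longrightarrow> Y \<in> C \<Longrightarrow> X \<subseteq> Y \<or> Y \<subseteq> X"
      by (auto simp: subset_chain_def)
    have "x + y \<in> \<Union>C" if xy: "x \<in> \<Union>C" "y \<in> \<Union>C" for x y
    proof -
      obtain X Y where XY: "X \<in> C" "x \<in> X" "Y \<in> C" "y \<in> Y"
        using xy by blast
      then obtain Z where "Z \<in> C" "x \<in> Z" "y \<in> Z"
        using lin[of X Y] by blast
      then show ?thesis using is_idealD(2)[of Z x y] sub by blast
    qed
    moreover have "r * x \<in> \<Union>C" if "x \<in> \<Union>C" for r x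
      using that sub is_idealD(3) by blast
    moreover have "0 \<in> \<Union>C"
      using C(1) sub is_idealD(1) by blast
    ultimately have "is_ideal (\<Union>C)"
      unfolding is_ideal_def by blast
    then show "\<Union>C \<in> ?A"
      using C(1) sub by blast
  qed
  then obtain M where "M \<in> ?A" and max: "\<forall>X\<in>?A. M \<subseteq> X \<longrightarrow> X = M"
    by (rule bexE)
  then have M: "is_ideal M" "1 \<notin> M" "I \<subseteq> M"
    by auto
  have "\<exists>y. x * y - 1 \<in> M" if "x \<notin> M" for x
  proof -
    let ?X = "{m + r * x | m r. m \<in> M}"
    have X: "m + r * x \<in> ?X" if "m \<in> M" for m r
      using that by blast
    have "M \<subseteq> ?X"
    proof
      fix m assume "m \<in> M"
      then show "m \<in> ?X" using X[of m 0] by simp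
    qed
    have "x \<in> ?X"
      using X[OF is_idealD(1)[OF M(1)], of 1] by simp
    have "is_ideal ?X"
      unfolding is_ideal_def
    proof (intro conjI ballI allI)
      show "0 \<in> ?X"
        using X[OF is_idealD(1)[OF M(1)], of 0] by simp
    next
      fix u v assume "u \<in> ?X" "v \<in> ?X"
      then obtain m r m' r' where mr: "u = m + r * x" "m \<in> M" "v = m' + r' * x" "m' \<in> M"
        by blast
      then have "u + v = (m + m') + (r + r') * x"
        by (simp add: algebra_simps)
      then show "u + v \<in> ?X"
        using X[OF is_idealD(2)[OF M(1) mr(2,4)], of "r + r'"] by simp
    next
      fix s u assume "u \<in> ?X"
      then obtain m r where mr: "u = m + r * x" "m \<in> M"
        by blast
      then have "s * u = s * m + (s * r) * x"
        by (simp add: algebra_simps)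
      then show "s * u \<in> ?X"
        using X[OF is_idealD(3)[OF M(1) mr(2)], of s "s * r"] by simp
    qed
    have "1 \<in> ?X"
    proof (rule ccontr)
      assume "1 \<notin> ?X"
      then have "?X \<in> ?A"
        using \<open>is_ideal ?X\<close> \<open>M \<subseteq> ?X\<close> M(3) by simp
      then have "?X = M"
        using max \<open>M \<subseteq> ?X\<close> by simp
      then show False
        using \<open>x \<in> ?X\<close> that by simp
    qed
    then obtain m r where "m \<in> M" "1 = m + r * x"
      by blast
    then have "x * r - 1 = 0 - m" by (simp add: algebra_simps)
    also have "\<dots> \<in> M"
      using is_idealD(1,5)[OF M(1)] \<open>m \<in> M\<close> by blast
    finally show ?thesis by blast
  qed
  with M show ?thesis using that by blast
qed

text \<open>An element of least degree divides all others, so a root of it would be a common root;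
  over an algebraically closed field it must therefore be constant.\<close>

lemma poly_ideal_without_root:
  fixes Q :: "'k::alg_closed_field poly set"
  assumes Q: "is_ideal Q" and root: "\<And>\<xi>. \<exists>q\<in>Q. poly q \<xi> \<noteq> 0"
  shows "1 \<in> Q"
proof -
  obtain q0 where "q0 \<in> Q" "poly q0 0 \<noteq> 0"
    using root by blast
  then have "q0 \<in> Q" "q0 \<noteq> 0" by auto
  then obtain q where q: "q \<in> Q" "q \<noteq> 0"
    and min: "\<And>q'. q' \<in> Q \<Longrightarrow> q' \<noteq> 0 \<Longrightarrow> degree q \<le> degree q'"
    using ex_has_least_nat[of "\<lambda>q. q \<in> Q \<and> q \<noteq> 0" q0 degree] by blast
  have dvd: "q dvd q'" if "q' \<in> Q" for q'
  proof -
    have "q' mod q = q' - q' div q * q"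
      by (simp add: minus_div_mult_eq_mod)
    then have "q' mod q \<in> Q"
      using is_idealD(3,5)[OF Q] that q(1) by auto
    then have "q' mod q = 0"
      using min[of "q' mod q"] degree_mod_less[OF q(2), of q'] by fastforce
    then show ?thesis by (simp add: dvd_eq_mod_eq_0)
  qed
  have "degree q = 0"
  proof (rule ccontr)
    assume "degree q \<noteq> 0"
    then obtain \<xi> where "poly q \<xi> = 0"
      using alg_closed_imp_poly_has_root[of q] by auto
    moreover obtain q' where "q' \<in> Q" "poly q' \<xi> \<noteq> 0"
      using root by blast
    ultimately show False
      using dvd[of q'] by (auto elim!: dvdE)
  qed
  then obtain c where "q = [:c:]" "c \<noteq> 0"
    using q(2) by (metis degree_eq_zeroE pCons_0_0)
  then have "1 = [:inverse c:] * q" by (simp add: one_pCons)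
  then show ?thesis using is_idealD(3)[OF Q q(1)] by metis
qed

text \<open>The graph of a ring homomorphism onto \<open>'k\<close>, defined on a \<open>'k\<close>-subalgebra that contains
  \<open>M\<close> and vanishing on \<open>M\<close>; being single-valued amounts to \<open>(0, 1) \<notin> G\<close>. For a maximal ideal
  \<open>M\<close>, a maximal such graph is a place of the residue field of \<open>M\<close>, which avoids forming the quotient.\<close>

definition place_graph :: "('k::field \<Rightarrow> 'a::comm_ring_1) \<Rightarrow> 'a set \<Rightarrow> ('a \<times> 'k) set \<Rightarrow> bool" where
  "place_graph \<iota> M G \<longleftrightarrow> (\<forall>c. (\<iota> c, c) \<in> G) \<and> (\<forall>x\<in>M. (x, 0) \<in> G) \<and>
     (\<forall>x c y d. (x, c) \<in> G \<longrightarrow> (y, d) \<in> G \<longrightarrow> (x + y, c + d) \<in> G \<and> (x * y, c * d) \<in> G) \<and>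
     (0, 1) \<notin> G"

locale residue_algebra =
  fixes \<iota> :: "'k::alg_closed_field \<Rightarrow> 'a::comm_ring_1" and M :: "'a set"
  assumes \<iota>_add: "\<iota> (c + d) = \<iota> c + \<iota> d" and \<iota>_mult: "\<iota> (c * d) = \<iota> c * \<iota> d" and \<iota>_1: "\<iota> 1 = 1"
    and M_ideal: "is_ideal M" and M_proper: "1 \<notin> M"
    and M_inverse: "x \<notin> M \<Longrightarrow> \<exists>y. x * y - 1 \<in> M"
begin

lemma \<iota>_0: "\<iota> 0 = 0"
  using \<iota>_add[of 0 0] by simp

lemma \<iota>_minus_1: "\<iota> (-1) = -1"
  using \<iota>_add[of 1 "-1"] by (simp add: \<iota>_0 \<iota>_1 eq_neg_iff_add_eq_0 add.commute)

context
  fixes G assumes G: "place_graph \<iota> M G"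
begin

lemma graph_intros:
  shows "(\<iota> c, c) \<in> G" and "x \<in> M \<Longrightarrow> (x, 0) \<in> G" and "(0, 0) \<in> G" and "(1, 1) \<in> G"
    and "(x, c) \<in> G \<Longrightarrow> (y, d) \<in> G \<Longrightarrow> (x + y, c + d) \<in> G"
    and "(x, c) \<in> G \<Longrightarrow> (y, d) \<in> G \<Longrightarrow> (x * y, c * d) \<in> G"
proof -
  show "(\<iota> c, c) \<in> G" "x \<in> M \<Longrightarrow> (x, 0) \<in> G"
    "(x, c) \<in> G \<Longrightarrow> (y, d) \<in> G \<Longrightarrow> (x + y, c + d) \<in> G"
    "(x, c) \<in> G \<Longrightarrow> (y, d) \<in> G \<Longrightarrow> (x * y, c * d) \<in> G" for x c y d
    using G unfolding place_graph_def by blast+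
  from this(1)[of 0] this(1)[of 1] show "(0, 0) \<in> G" "(1, 1) \<in> G"
    by (simp_all add: \<iota>_0 \<iota>_1)
qed

lemma graph_diff:
  assumes "(x, c) \<in> G" "(y, d) \<in> G"
  shows "(x - y, c - d) \<in> G"
  using graph_intros(5)[OF assms(1) graph_intros(6)[OF graph_intros(1)[of "-1"] assms(2)]]
  by (simp add: \<iota>_minus_1)

lemma graph_sum:
  assumes "\<And>i. i \<in> A \<Longrightarrow> (f i, g i) \<in> G"
  shows "(\<Sum>i\<in>A. f i, \<Sum>i\<in>A. g i) \<in> G"
  using assms by (induction A rule: infinite_finite_induct) (auto intro: graph_intros)

lemma graph_prod:
  assumes "\<And>i. i \<in> A \<Longrightarrow> (f i, g i) \<in> G"
  shows "(\<Prod>i\<in>A. f i, \<Prod>i\<in>A. g i) \<in> G"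
  using assms by (induction A rule: infinite_finite_induct) (auto intro: graph_intros)

lemma graph_power:
  assumes "(x, c) \<in> G"
  shows "(x ^ j, c ^ j) \<in> G"
  using assms by (induction j) (auto intro: graph_intros)

lemma graph_fun:
  assumes "(x, c) \<in> G" "(x, d) \<in> G"
  shows "c = d"
proof (rule ccontr)
  assume "c \<noteq> d"
  then have "(0, 1) \<in> G"
    using graph_intros(6)[OF graph_intros(1)[of "inverse (c - d)"] graph_diff[OF assms]] by simp
  then show False using G by (simp add: place_graph_def)
qed

lemma graph_cong:
  assumes "(x, c) \<in> G" "x - y \<in> M"
  shows "(y, c) \<in> G"
  using graph_diff[OF assms(1) graph_intros(2)[OF assms(2)]] by simp

text \<open>This extends the place to polynomials in \<open>x\<close> over its valuation ring by
  sending \<open>x\<close> to \<open>\<xi>\<close>. Closure under the ring operations is automatic,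
  so being single-valued is the only condition.\<close>

lemma graph_adjoin:
  fixes x \<xi>
  defines "G' \<equiv> {(poly p x, poly q \<xi>) | p q. \<forall>i. (coeff p i, coeff q i) \<in> G}"
  assumes "(0, 1) \<notin> G'"
  shows "place_graph \<iota> M G'" and "G \<subseteq> G'" and "(x, \<xi>) \<in> G'"
proof -
  have G'I: "(poly p x, poly q \<xi>) \<in> G'" if "\<forall>i. (coeff p i, coeff q i) \<in> G" for p q
    using that unfolding G'_def by blast
  show sub: "G \<subseteq> G'"
  proof
    fix z assume z: "z \<in> G"
    have "\<forall>i. (coeff [:fst z:] i, coeff [:snd z:] i) \<in> G"
      using z by (auto simp: coeff_pCons graph_intros split: nat.splits)
    from G'I[OF this] show "z \<in> G'" by simp
  qed
  have "\<forall>i. (coeff [:0, 1:] i, coeff [:0, 1:] i) \<in> G"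
    by (auto simp: coeff_pCons graph_intros split: nat.splits)
  from G'I[OF this] show "(x, \<xi>) \<in> G'" by simp
  have "(u + v, c + d) \<in> G' \<and> (u * v, c * d) \<in> G'" if "(u, c) \<in> G'" "(v, d) \<in> G'" for u c v d
  proof -
    obtain p q p' q' where pq: "u = poly p x" "c = poly q \<xi>" "v = poly p' x" "d = poly q' \<xi>"
      and co: "\<forall>i. (coeff p i, coeff q i) \<in> G" "\<forall>i. (coeff p' i, coeff q' i) \<in> G"
      using \<open>(u, c) \<in> G'\<close> \<open>(v, d) \<in> G'\<close> unfolding G'_def by auto
    have "\<forall>i. (coeff (p + p') i, coeff (q + q') i) \<in> G"
      using co by (auto intro: graph_intros)
    moreover have "\<forall>i. (coeff (p * p') i, coeff (q * q') i) \<in> G"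
      using co by (auto simp: coeff_mult intro!: graph_sum graph_intros)
    ultimately show ?thesis
      using G'I[of "p + p'" "q + q'"] G'I[of "p * p'" "q * q'"] pq by simp
  qed
  then show "place_graph \<iota> M G'"
    unfolding place_graph_def using sub graph_intros(1,2) assms(2) by blast
qed

text \<open>Obstruction to extending the place to \<open>x\<close>: it holds for some \<open>r\<close> iff, modulo \<open>M\<close>, the
  ideal \<open>{b. (b, 0) \<in> G}\<close> of the valuation ring \<open>fst ` G\<close> generates the unit ideal after
  adjoining \<open>x\<close>.\<close>

definition obstruction :: "'a \<Rightarrow> nat \<Rightarrow> bool" where
  "obstruction x r \<longleftrightarrow> (\<exists>b. (b 0, 1) \<in> G \<and> (\<forall>i. 0 < i \<longrightarrow> i \<le> r \<longrightarrow> (b i, 0) \<in> G) \<and>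
     (\<Sum>i\<le>r. b i * x ^ i) \<in> M)"

lemma not_obstruction_0: "\<not> obstruction x 0"
  using graph_fun graph_intros(2) unfolding obstruction_def by fastforce

text \<open>\<open>Q\<close> consists of the reductions to k of polynomials over the valuation ring
  that vanish at \<open>x\<close> modulo \<open>M\<close>. A common root of \<open>Q\<close> would
  be an admissible value for \<open>x\<close>, against maximality of \<open>G\<close>. So
  \<open>Q\<close> contains 1, and a polynomial reducing to 1 is an obstruction.\<close>

lemma exists_obstruction:
  assumes max: "\<And>G'. place_graph \<iota> M G' \<Longrightarrow> G \<subseteq> G' \<Longrightarrow> G' = G" and x: "x \<notin> fst ` G"
  shows "\<exists>r. obstruction x r"
proof -
  define Q where "Q = {q. \<exists>p. (\<forall>i. (coeff p i, coeff q i) \<in> G) \<and> poly p x \<in> M}"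
  have "is_ideal Q"
    unfolding is_ideal_def
  proof (intro conjI ballI allI)
    show "0 \<in> Q"
      unfolding Q_def using graph_intros(3) is_idealD(1)[OF M_ideal] by (auto intro!: exI[of _ 0])
  next
    fix q q' assume "q \<in> Q" "q' \<in> Q"
    then obtain p p' where "\<forall>i. (coeff p i, coeff q i) \<in> G" "\<forall>i. (coeff p' i, coeff q' i) \<in> G"
      "poly p x \<in> M" "poly p' x \<in> M"
      unfolding Q_def by blast
    then show "q + q' \<in> Q"
      unfolding Q_def by (auto intro!: exI[of _ "p + p'"] graph_intros is_idealD(2)[OF M_ideal])
  next
    fix h q assume "q \<in> Q"
    then obtain p where "\<forall>i. (coeff p i, coeff q i) \<in> G" "poly p x \<in> M"
      unfolding Q_def by blast
    then show "h * q \<in> Q"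
      unfolding Q_def
      by (auto intro!: exI[of _ "map_poly \<iota> h * p"] graph_intros graph_sum is_idealD(3)[OF M_ideal]
          simp: coeff_mult coeff_map_poly \<iota>_0)
  qed
  moreover have "\<exists>q\<in>Q. poly q \<xi> \<noteq> 0" for \<xi>
  proof (rule ccontr)
    assume neg: "\<not> (\<exists>q\<in>Q. poly q \<xi> \<noteq> 0)"
    let ?G = "{(poly p x, poly q \<xi>) | p q. \<forall>i. (coeff p i, coeff q i) \<in> G}"
    have "(0, 1) \<notin> ?G"
    proof
      assume "(0, 1) \<in> ?G"
      then obtain p q where "poly p x = 0" "poly q \<xi> = 1" "\<forall>i. (coeff p i, coeff q i) \<in> G"
        by auto
      then show False
        using neg is_idealD(1)[OF M_ideal] unfolding Q_def by force
    qed
    note adj = graph_adjoin[OF this]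
    have eq: "?G = G"
      by (rule max[OF adj(1,2)])
    from adj(3) have "(x, \<xi>) \<in> G"
      unfolding eq .
    then show False using x by force
  qed
  ultimately have "1 \<in> Q"
    by (rule poly_ideal_without_root)
  then obtain p where p: "\<forall>i. (coeff p i, coeff 1 i) \<in> G" "poly p x \<in> M"
    unfolding Q_def by blast
  have "obstruction x (degree p)"
    unfolding obstruction_def
  proof (intro exI conjI allI impI)
    show "(coeff p 0, 1) \<in> G"
      using p(1)[rule_format, of 0] by simp
    show "(coeff p i, 0) \<in> G" if "0 < i" for i
      using p(1)[rule_format, of i] that by simp
    show "(\<Sum>i\<le>degree p. coeff p i * x ^ i) \<in> M"
      using p(2) by (simp add: poly_altdef)
  qed
  then show ?thesis by blast
qed

lemma power_inverse_mod:
  assumes "x * y - 1 \<in> M"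
  shows "1 - x ^ j * y ^ j \<in> M"
proof (induction j)
  case 0
  then show ?case using is_idealD(1)[OF M_ideal] by simp
next
  case (Suc j)
  have "1 - x ^ Suc j * y ^ Suc j = (1 - x ^ j * y ^ j) - (x ^ j * y ^ j) * (x * y - 1)"
    by (simp add: algebra_simps)
  also have "\<dots> \<in> M"
    by (intro is_idealD(3,5)[OF M_ideal] Suc assms)
  finally show ?case .
qed

text \<open>Modulo \<open>M\<close>, \<open>y\<close> is the inverse of \<open>x\<close>.
  Multiplying the relation for \<open>y\<close> by \<open>x ^ r\<close> turns it into a relation in
  \<open>x\<close> with leading term \<open>b' 0 * x ^ r\<close>, where \<open>s \<le> r\<close>
  keeps all exponents non-negative. Cross-multiplication then eliminates the leading term of the
  relation for \<open>x\<close>.\<close>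

lemma obstruction_reduce:
  assumes "obstruction x r" "obstruction y s" "s \<le> r" and xy: "x * y - 1 \<in> M"
  shows "obstruction x (r - 1)"
proof -
  obtain b where b: "(b 0, 1) \<in> G" "\<And>i. 0 < i \<Longrightarrow> i \<le> r \<Longrightarrow> (b i, 0) \<in> G"
    and bM: "(\<Sum>i\<le>r. b i * x ^ i) \<in> M"
    using assms(1) unfolding obstruction_def by blast
  obtain b' where b': "(b' 0, 1) \<in> G" "\<And>i. 0 < i \<Longrightarrow> i \<le> s \<Longrightarrow> (b' i, 0) \<in> G"
    and bM': "(\<Sum>i\<le>s. b' i * y ^ i) \<in> M"
    using assms(2) unfolding obstruction_def by blast
  have "r > 0"
    using assms(1) not_obstruction_0 by (cases r) auto
  \<comment> \<open>At \<open>i = r\<close> the two products cancel. The other residues are those of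
    \<open>b\<close>: \<open>b' 0\<close> has residue 1, and \<open>b r\<close> has residue 0
    because \<open>r\<close> is positive.\<close>
  define q where "q i = b' 0 * b i - (if r - s \<le> i then b r * b' (r - i) else 0)" for i
  have "(\<Sum>i\<in>{r - s..r}. b' (r - i) * x ^ i) = (\<Sum>j\<le>s. b' j * x ^ (r - j))"
    using \<open>s \<le> r\<close> by (intro sum.reindex_bij_witness[of _ "\<lambda>j. r - j" "\<lambda>i. r - i"]) auto
  also have "\<dots> = (\<Sum>j\<le>s. b' j * x ^ (r - j) * (1 - x ^ j * y ^ j)) + x ^ r * (\<Sum>j\<le>s. b' j * y ^ j)"
    unfolding sum_distrib_left sum.distrib[symmetric]
  proof (rule sum.cong)
    fix j assume "j \<in> {..s}"
    then have "x ^ r = x ^ (r - j) * x ^ j"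
      using \<open>s \<le> r\<close> by (simp flip: power_add)
    then show "b' j * x ^ (r - j) = b' j * x ^ (r - j) * (1 - x ^ j * y ^ j) + x ^ r * (b' j * y ^ j)"
      by (simp add: algebra_simps)
  qed simp
  also have "\<dots> \<in> M"
    by (intro is_idealD(2)[OF M_ideal] is_ideal_sum[OF M_ideal] is_idealD(3)[OF M_ideal]
        power_inverse_mod xy bM')
  finally have M': "(\<Sum>i\<in>{r - s..r}. b' (r - i) * x ^ i) \<in> M" .
  have "(\<Sum>i\<le>r. q i * x ^ i) = b' 0 * (\<Sum>i\<le>r. b i * x ^ i)
      - (\<Sum>i\<le>r. if r - s \<le> i then b r * (b' (r - i) * x ^ i) else 0)"
    unfolding q_def sum_distrib_left sum_subtractf[symmetric]
    by (intro sum.cong refl) (simp add: algebra_simps)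
  also have "(\<Sum>i\<le>r. if r - s \<le> i then b r * (b' (r - i) * x ^ i) else 0)
      = (\<Sum>i\<in>{r - s..r}. b r * (b' (r - i) * x ^ i))"
    by (intro sum.mono_neutral_cong_right) auto
  also have "\<dots> = b r * (\<Sum>i\<in>{r - s..r}. b' (r - i) * x ^ i)"
    by (simp add: sum_distrib_left)
  also have "b' 0 * (\<Sum>i\<le>r. b i * x ^ i) - \<dots> \<in> M"
    using bM M' is_idealD(3,5)[OF M_ideal] by blast
  finally have "(\<Sum>i\<le>r. q i * x ^ i) \<in> M" .
  moreover have "(\<Sum>i\<le>r. q i * x ^ i) = (\<Sum>i\<le>r - 1. q i * x ^ i)"
    using \<open>r > 0\<close> by (cases r) (simp_all add: q_def mult.commute)
  moreover have "(q 0, 1) \<in> G"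
  proof -
    have "(if r - s \<le> 0 then b r * b' (r - 0) else 0, 0) \<in> G"
      using graph_intros(6)[OF b(2)[of r] b'(2)[of r]] \<open>s \<le> r\<close> \<open>r > 0\<close> graph_intros(3) by simp
    from graph_diff[OF graph_intros(6)[OF b'(1) b(1)] this] show ?thesis
      unfolding q_def by simp
  qed
  moreover have "(q i, 0) \<in> G" if "0 < i" "i \<le> r - 1" for i
  proof -
    have "(if r - s \<le> i then b r * b' (r - i) else 0, 0) \<in> G"
      using graph_intros(6)[OF b(2)[of r] b'(2)[of "r - i"]] \<open>s \<le> r\<close> \<open>r > 0\<close> that graph_intros(3) by simp
    moreover have "(b i, 0) \<in> G"
      using b(2) that by simp
    ultimately show ?thesis
      using graph_diff[OF graph_intros(6)[OF b'(1), of "b i" 0]] unfolding q_def by fastforce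
  qed
  ultimately show ?thesis
    unfolding obstruction_def by (intro exI[of _ q]) auto
qed

text \<open>If neither had a value, take obstructions of least degree for both; the one of larger
  degree could be shortened with the help of the other.\<close>

lemma graph_valuation:
  assumes max: "\<And>G'. place_graph \<iota> M G' \<Longrightarrow> G \<subseteq> G' \<Longrightarrow> G' = G" and xy: "x * y - 1 \<in> M"
  shows "x \<in> fst ` G \<or> y \<in> fst ` G"
proof (rule ccontr)
  assume "\<not> ?thesis"
  then have ex: "\<exists>r. obstruction x r" "\<exists>r. obstruction y r"
    using exists_obstruction[OF max] by auto
  define r s where "r = (LEAST r. obstruction x r)" and "s = (LEAST s. obstruction y s)"
  have r: "obstruction x r" and s: "obstruction y s"
    unfolding r_def s_def using ex by (auto intro: LeastI_ex)
  then have pos: "r > 0" "s > 0"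
    using not_obstruction_0 by (auto intro!: gr0I)
  have "\<not> obstruction x (r - 1)" "\<not> obstruction y (s - 1)"
    using pos not_less_Least[of "r - 1" "obstruction x"] not_less_Least[of "s - 1" "obstruction y"]
    unfolding r_def s_def by auto
  then show False
    using obstruction_reduce[OF r s _ xy] obstruction_reduce[OF s r] xy
    by (metis mult.commute nat_le_linear)
qed

end

section \<open>Existence of places and the points they define\<close>

lemma exists_maximal_place_graph:
  obtains G where "place_graph \<iota> M G" "\<And>G'. place_graph \<iota> M G' \<Longrightarrow> G \<subseteq> G' \<Longrightarrow> G' = G"
proof -
  have "\<exists>G\<in>Collect (place_graph \<iota> M). \<forall>X\<in>Collect (place_graph \<iota> M). G \<subseteq> X \<longrightarrow> X = G"
  proof (rule subset_Zorn_nonempty)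
    \<comment> \<open>The smallest candidate: the projection of k + \<open>M\<close> onto k,
      single-valued because \<open>M\<close> is proper.\<close>
    let ?G = "{(\<iota> c + x, c) | c x. x \<in> M}"
    have "(\<iota> c + x + (\<iota> d + y), c + d) \<in> ?G" if "x \<in> M" "y \<in> M" for c d x y
      using that is_idealD(2)[OF M_ideal] by (auto simp: \<iota>_add intro!: exI[of _ "x + y"])
    moreover have "((\<iota> c + x) * (\<iota> d + y), c * d) \<in> ?G" if "x \<in> M" "y \<in> M" for c d x y
      using that by (auto simp: \<iota>_mult algebra_simps intro!: exI[of _ "\<iota> c * y + (x * \<iota> d + x * y)"]
        is_idealD[OF M_ideal])
    moreover have "(\<iota> c, c) \<in> ?G" for c
      using is_idealD(1)[OF M_ideal] by (auto intro!: exI[of _ 0])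
    moreover have "(x, 0) \<in> ?G" if "x \<in> M" for x
      using that by (simp add: \<iota>_0)
    moreover have "(0, 1) \<notin> ?G"
    proof
      assume "(0, 1) \<in> ?G"
      then obtain x where "x \<in> M" "0 = 1 + x"
        by (auto simp: \<iota>_1)
      then have "1 = 0 - x" by (simp add: eq_neg_iff_add_eq_0)
      also have "\<dots> \<in> M"
        using is_idealD(1,5)[OF M_ideal] \<open>x \<in> M\<close> by blast
      finally show False using M_proper by simp
    qed
    ultimately have "place_graph \<iota> M ?G"
      unfolding place_graph_def by fast
    then show "Collect (place_graph \<iota> M) \<noteq> {}" by blast
  next
    fix C assume C: "C \<noteq> {}" "subset.chain (Collect (place_graph \<iota> M)) C"
    then have sub: "C \<subseteq> Collect (place_graph \<iota> M)"
      and lin: "\<And>X Y. X \<in> C \<Longrightarrow> Y \<in> C \<Longrightarrow> X \<subseteq> Y \<or> Y \<subseteq> X"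
      by (auto simp: subset_chain_def)
    have "(x + y, c + d) \<in> \<Union>C \<and> (x * y, c * d) \<in> \<Union>C" if xy: "(x, c) \<in> \<Union>C" "(y, d) \<in> \<Union>C" for x c y d
    proof -
      obtain X Y where XY: "X \<in> C" "(x, c) \<in> X" "Y \<in> C" "(y, d) \<in> Y"
        using xy by blast
      then obtain Z where "Z \<in> C" "(x, c) \<in> Z" "(y, d) \<in> Z"
        using lin[of X Y] by blast
      then show ?thesis using graph_intros(5,6)[of Z] sub by blast
    qed
    moreover obtain X where "X \<in> C"
      using C(1) by blast
    moreover from this have "place_graph \<iota> M X"
      using sub by blast
    moreover have "(0, 1) \<notin> \<Union>C"
      using sub by (auto simp: place_graph_def)
    ultimately have "place_graph \<iota> M (\<Union>C)"
      unfolding place_graph_def by blast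
    then show "\<Union>C \<in> Collect (place_graph \<iota> M)" by simp
  qed
  then show ?thesis using that by blast
qed

text \<open>Coordinates in \<open>M\<close> receive the value 0. Among the remaining ones
  divisibility in the valuation ring is a total preorder, so finitely many of them have a least
  element \<open>t l\<close>, and \<open>y\<close> is an inverse of it modulo
  \<open>M\<close>.\<close>

lemma exists_place_point:
  fixes t :: "nat \<Rightarrow> 'a"
  assumes N: "finite N" and t: "\<exists>i\<in>N. t i \<notin> M"
  obtains G y x l where "place_graph \<iota> M G" "l \<in> N" "x l = 1" "\<And>i. i \<in> N \<Longrightarrow> (t i * y, x i) \<in> G"
proof -
  obtain G where G: "place_graph \<iota> M G"
    and max: "\<And>G'. place_graph \<iota> M G' \<Longrightarrow> G \<subseteq> G' \<Longrightarrow> G' = G"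
    using exists_maximal_place_graph by blast
  have "\<forall>i. \<exists>z. t i \<notin> M \<longrightarrow> t i * z - 1 \<in> M"
    using M_inverse by blast
  from choice[OF this] obtain y where y: "\<And>i. t i \<notin> M \<Longrightarrow> t i * y i - 1 \<in> M"
    by blast
  have self: "(t i * y i, 1) \<in> G" if "t i \<notin> M" for i
    using graph_cong[OF G graph_intros(4)[OF G], of "t i * y i"] is_idealD(1,5)[OF M_ideal] y[OF that]
    by (metis diff_0 minus_diff_eq)
  \<comment> \<open>\<open>y l\<close> plays the role of the reciprocal of \<open>t l\<close>, so
    the claim is that \<open>t l\<close> has minimal valuation on \<open>T\<close>. A new element is
    compared with the previous minimum only; transitivity does the rest.\<close>
  have chain: "\<exists>l\<in>T. \<forall>i\<in>T. t i * y l \<in> fst ` G"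
    if "finite T" "T \<noteq> {}" "\<forall>i\<in>T. t i \<notin> M" for T
    using that
  proof (induction T rule: finite_ne_induct)
    case (singleton a)
    then show ?case using self[of a] by (auto intro: rev_image_eqI)
  next
    case (insert a T)
    then obtain l where l: "l \<in> T" "\<forall>i\<in>T. t i * y l \<in> fst ` G"
      by auto
    have a: "t a * y a - 1 \<in> M" "t l * y l - 1 \<in> M"
      using insert l y by auto
    have "(t a * y l) * (t l * y a) - 1 = (t a * y a) * (t l * y l - 1) + (t a * y a - 1)"
      by (simp add: algebra_simps)
    then have "(t a * y l) * (t l * y a) - 1 \<in> M"
      using a is_idealD[OF M_ideal] by metis
    then consider "t a * y l \<in> fst ` G" | "t l * y a \<in> fst ` G"
      using graph_valuation[OF G max] by blast
    then show ?case
    proof cases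
      case 1
      then show ?thesis using l by blast
    next
      case 2
      have "t i * y a \<in> fst ` G" if "i \<in> T" for i
      proof -
        obtain c d where "(t i * y l, c) \<in> G" "(t l * y a, d) \<in> G"
          using l(2) 2 \<open>i \<in> T\<close> by fastforce
        from graph_intros(6)[OF G this] have "((t i * y l) * (t l * y a), c * d) \<in> G" .
        moreover have "(t i * y l) * (t l * y a) - t i * y a = (t i * y a) * (t l * y l - 1)"
          by (simp add: algebra_simps)
        then have "(t i * y l) * (t l * y a) - t i * y a \<in> M"
          using a is_idealD(3)[OF M_ideal] by metis
        ultimately have "(t i * y a, c * d) \<in> G"
          by (rule graph_cong[OF G])
        then show ?thesis by force
      qed
      moreover have "t a * y a \<in> fst ` G"
        using self[of a] insert.prems by force
      ultimately show ?thesis by blast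
    qed
  qed
  have "\<exists>l\<in>{i\<in>N. t i \<notin> M}. \<forall>i\<in>{i\<in>N. t i \<notin> M}. t i * y l \<in> fst ` G"
  proof (rule chain)
    show "finite {i\<in>N. t i \<notin> M}" using N by simp
    show "{i\<in>N. t i \<notin> M} \<noteq> {}" using t by blast
  qed simp
  then obtain l where "l \<in> {i\<in>N. t i \<notin> M}" and lG: "\<forall>i\<in>{i\<in>N. t i \<notin> M}. t i * y l \<in> fst ` G"
    by (rule bexE)
  then have l: "l \<in> N" "t l \<notin> M"
    by auto
  have "\<exists>c. (t i * y l, c) \<in> G" if "i \<in> N" for i
  proof (cases "t i \<in> M")
    case True
    then show ?thesis
      using graph_intros(2)[OF G] is_idealD(4)[OF M_ideal] by blast
  next
    case False
    then have "t i * y l \<in> fst ` G"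
      using lG that by simp
    then show ?thesis by fastforce
  qed
  then obtain x where x: "\<And>i. i \<in> N \<Longrightarrow> (t i * y l, x i) \<in> G"
    by metis
  moreover have "x l = 1"
    using graph_fun[OF G x[OF l(1)] self[OF l(2)]] .
  ultimately show ?thesis
    using that[OF G l(1)] by blast
qed

end

section \<open>Polynomials\<close>

lemma poly_mapping_expand: "(\<Sum>s\<in>Poly_Mapping.keys f. Poly_Mapping.single s (Poly_Mapping.lookup f s)) = f"
proof (rule poly_mapping_eqI)
  fix k
  have "Poly_Mapping.lookup (\<Sum>s\<in>Poly_Mapping.keys f. Poly_Mapping.single s (Poly_Mapping.lookup f s)) k
      = (\<Sum>s\<in>Poly_Mapping.keys f. if s = k then Poly_Mapping.lookup f s else 0)"
    by (simp add: lookup_sum lookup_single when_def)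
  also have "\<dots> = Poly_Mapping.lookup f k"
    by (auto simp: in_keys_iff)
  finally show "Poly_Mapping.lookup (\<Sum>s\<in>Poly_Mapping.keys f. Poly_Mapping.single s (Poly_Mapping.lookup f s)) k
      = Poly_Mapping.lookup f k" .
qed

lemma poly_mapping_add_induct [case_names single add]:
  fixes f :: "'a \<Rightarrow>\<^sub>0 'b::comm_monoid_add"
  assumes "\<And>s c. P (Poly_Mapping.single s c)" and "\<And>f g. P f \<Longrightarrow> P g \<Longrightarrow> P (f + g)"
  shows "P f"
proof -
  have "P 0"
    using assms(1)[of undefined 0] by simp
  then have "P (\<Sum>s\<in>A. Poly_Mapping.single s (Poly_Mapping.lookup f s))" for A
    by (induction A rule: infinite_finite_induct) (auto intro: assms)
  from this[of "Poly_Mapping.keys f"] show ?thesis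
    by (simp only: poly_mapping_expand)
qed

definition var :: "nat \<Rightarrow> 'k::comm_semiring_1 mpoly" where
  "var i = Poly_Mapping.single (Poly_Mapping.single i 1) 1"

lemma var_power: "var i ^ N = Poly_Mapping.single (Poly_Mapping.single i N) 1"
proof (induction N)
  case (Suc N)
  then show ?case
    by (simp add: var_def mult_single flip: single_add)
qed simp

lemma prod_var_power:
  "(\<Prod>i\<in>Poly_Mapping.keys s. var i ^ Poly_Mapping.lookup s i) = Poly_Mapping.single s 1"
proof -
  have "(\<Prod>i\<in>A. var i ^ g i) = Poly_Mapping.single (\<Sum>i\<in>A. Poly_Mapping.single i (g i)) 1"
    for A and g :: "nat \<Rightarrow> nat"
    by (induction A rule: infinite_finite_induct) (simp_all add: var_power mult_single)
  from this[of "Poly_Mapping.lookup s" "Poly_Mapping.keys s"] show ?thesis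
    by (simp only: poly_mapping_expand)
qed

lemma const_poly_hom:
  fixes c d :: "'k::comm_semiring_1"
  shows
  "const_poly (c + d) = const_poly c + const_poly d"
  "const_poly (c * d) = const_poly c * const_poly d"
  "const_poly (1::'k) = 1" "const_poly (0::'k) = 0"
  by (simp_all add: const_poly_def single_add mult_single)

section \<open>Substitution\<close>

definition monom_value :: "(nat \<Rightarrow> 'a::comm_semiring_1) \<Rightarrow> (nat \<Rightarrow>\<^sub>0 nat) \<Rightarrow> 'a" where
  "monom_value u s = (\<Prod>i\<in>Poly_Mapping.keys s. u i ^ Poly_Mapping.lookup s i)"

lemma monom_value_superset:
  assumes "finite A" "Poly_Mapping.keys s \<subseteq> A"
  shows "monom_value u s = (\<Prod>i\<in>A. u i ^ Poly_Mapping.lookup s i)"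
  unfolding monom_value_def using assms
  by (intro prod.mono_neutral_left) (auto simp: in_keys_iff)

lemma monom_value_add: "monom_value u (s + t) = monom_value u s * monom_value u t"
proof -
  let ?A = "Poly_Mapping.keys s \<union> Poly_Mapping.keys t"
  have "monom_value u (s + t) = (\<Prod>i\<in>?A. u i ^ Poly_Mapping.lookup (s + t) i)"
    by (intro monom_value_superset keys_add) simp
  also have "\<dots> = (\<Prod>i\<in>?A. u i ^ Poly_Mapping.lookup s i) * (\<Prod>i\<in>?A. u i ^ Poly_Mapping.lookup t i)"
    by (simp add: lookup_add power_add prod.distrib)
  also have "\<dots> = monom_value u s * monom_value u t"
    by (simp add: monom_value_superset[of ?A])
  finally show ?thesis .
qed

lemma monom_value_single: "monom_value u (Poly_Mapping.single i j) = u i ^ j"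
  by (simp add: monom_value_def)

text \<open>The coefficient map serves three targets: k itself, the polynomial ring at multiples of
  the variables, and the fraction field at ratios of coordinates.\<close>

definition subst_poly ::
  "('k::comm_semiring_1 \<Rightarrow> 'a::comm_semiring_1) \<Rightarrow> (nat \<Rightarrow> 'a) \<Rightarrow> 'k mpoly \<Rightarrow> 'a" where
  "subst_poly \<phi> u f = (\<Sum>s\<in>Poly_Mapping.keys f. \<phi> (Poly_Mapping.lookup f s) * monom_value u s)"

lemma eval_poly_conv_subst: "eval_poly x f = subst_poly (\<lambda>c. c) x f"
  by (simp add: eval_poly_def subst_poly_def monom_value_def)

context
  fixes \<phi> :: "'k::comm_semiring_1 \<Rightarrow> 'a::comm_semiring_1"
  assumes hom: "\<And>c d. \<phi> (c + d) = \<phi> c + \<phi> d" "\<And>c d. \<phi> (c * d) = \<phi> c * \<phi> d" "\<phi> 0 = 0" "\<phi> 1 = 1"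
begin

lemma subst_poly_superset:
  assumes "finite A" "Poly_Mapping.keys f \<subseteq> A"
  shows "subst_poly \<phi> u f = (\<Sum>s\<in>A. \<phi> (Poly_Mapping.lookup f s) * monom_value u s)"
  unfolding subst_poly_def using assms
  by (intro sum.mono_neutral_left) (auto simp: in_keys_iff hom)

lemma subst_poly_add: "subst_poly \<phi> u (f + g) = subst_poly \<phi> u f + subst_poly \<phi> u g"
proof -
  let ?A = "Poly_Mapping.keys f \<union> Poly_Mapping.keys g"
  have "subst_poly \<phi> u (f + g) = (\<Sum>s\<in>?A. \<phi> (Poly_Mapping.lookup (f + g) s) * monom_value u s)"
    by (intro subst_poly_superset keys_add) simp
  also have "\<dots> = (\<Sum>s\<in>?A. \<phi> (Poly_Mapping.lookup f s) * monom_value u s)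
      + (\<Sum>s\<in>?A. \<phi> (Poly_Mapping.lookup g s) * monom_value u s)"
    by (simp add: lookup_add hom distrib_right sum.distrib)
  also have "\<dots> = subst_poly \<phi> u f + subst_poly \<phi> u g"
    by (simp add: subst_poly_superset[of ?A])
  finally show ?thesis .
qed

lemma subst_poly_single: "subst_poly \<phi> u (Poly_Mapping.single s c) = \<phi> c * monom_value u s"
  by (simp add: subst_poly_def hom)

lemma subst_poly_0: "subst_poly \<phi> u 0 = 0"
  by (simp add: subst_poly_def)

lemma subst_poly_mult: "subst_poly \<phi> u (f * g) = subst_poly \<phi> u f * subst_poly \<phi> u g"
proof (induction f rule: poly_mapping_add_induct)
  case (single s c)
  show ?case
  proof (induction g rule: poly_mapping_add_induct)
    case (single t d)
    then show ?case
      by (simp add: mult_single subst_poly_single monom_value_add hom mult_ac)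
  qed (simp add: distrib_left subst_poly_add)
qed (simp add: distrib_right subst_poly_add)

lemma subst_poly_sum: "subst_poly \<phi> u (\<Sum>i\<in>A. f i) = (\<Sum>i\<in>A. subst_poly \<phi> u (f i))"
  by (induction A rule: infinite_finite_induct) (simp_all add: subst_poly_add subst_poly_0)

lemma subst_poly_of_nat: "subst_poly \<phi> u (of_nat j) = of_nat j"
proof (induction j)
  case (Suc j)
  have "subst_poly \<phi> u 1 = 1"
    using subst_poly_single[of u 0 1] by (simp add: hom monom_value_def)
  with Suc show ?case by (simp add: subst_poly_add)
qed (simp add: subst_poly_0)

end

section \<open>Homogeneous polynomials\<close>

lemma monom_degree_superset:
  assumes "finite A" "Poly_Mapping.keys s \<subseteq> A"
  shows "monom_degree s = (\<Sum>i\<in>A. Poly_Mapping.lookup s i)"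
  unfolding monom_degree_def using assms
  by (intro sum.mono_neutral_left) (auto simp: in_keys_iff)

lemma monom_degree_add: "monom_degree (s + t) = monom_degree s + monom_degree t"
proof -
  let ?A = "Poly_Mapping.keys s \<union> Poly_Mapping.keys t"
  have "monom_degree (s + t) = (\<Sum>i\<in>?A. Poly_Mapping.lookup (s + t) i)"
    by (intro monom_degree_superset keys_add) simp
  then show ?thesis
    by (simp add: lookup_add sum.distrib monom_degree_superset[of ?A])
qed

lemma monom_degree_single: "monom_degree (Poly_Mapping.single i j) = j"
  by (simp add: monom_degree_def)

lemma homogD:
  assumes "f \<in> homog n e" "s \<in> Poly_Mapping.keys f"
  shows "Poly_Mapping.keys s \<subseteq> {..n}" and "monom_degree s = e"
  using assms by (auto simp: homog_def)

lemma homog_0: "0 \<in> homog n e"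
  by (simp add: homog_def)

lemma homog_single:
  assumes "c \<noteq> 0 \<Longrightarrow> Poly_Mapping.keys s \<subseteq> {..n} \<and> monom_degree s = e"
  shows "Poly_Mapping.single s c \<in> homog n e"
  using assms by (cases "c = 0") (auto simp: homog_def)

lemma homog_const: "const_poly c \<in> homog n 0"
  unfolding const_poly_def by (intro homog_single) (simp add: monom_degree_def)

lemma homog_1: "(1 :: 'k::comm_semiring_1 mpoly) \<in> homog n 0"
  using homog_const[of "1::'k"] by (simp add: const_poly_hom)

lemma homog_var: "i \<le> n \<Longrightarrow> var i \<in> homog n 1"
  unfolding var_def by (intro homog_single) (simp add: monom_degree_single)

lemma homog_add: "f \<in> homog n e \<Longrightarrow> g \<in> homog n e \<Longrightarrow> f + g \<in> homog n e"
  using keys_add[of f g] unfolding homog_def by blast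

lemma homog_sum: "(\<And>i. i \<in> A \<Longrightarrow> f i \<in> homog n e) \<Longrightarrow> (\<Sum>i\<in>A. f i) \<in> homog n e"
  by (induction A rule: infinite_finite_induct) (auto intro: homog_add homog_0)

lemma homog_mult:
  assumes "f \<in> homog n e" "g \<in> homog n e'"
  shows "f * g \<in> homog n (e + e')"
  unfolding homog_def
proof (intro CollectI ballI)
  fix s assume "s \<in> Poly_Mapping.keys (f * g)"
  then obtain a b where ab: "s = a + b" "a \<in> Poly_Mapping.keys f" "b \<in> Poly_Mapping.keys g"
    using keys_mult[of f g] by blast
  then show "Poly_Mapping.keys s \<subseteq> {..n} \<and> monom_degree s = e + e'"
    using homogD[OF assms(1) ab(2)] homogD[OF assms(2) ab(3)] keys_add[of a b]
    by (auto simp: monom_degree_add)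
qed

lemma homog_power:
  fixes f :: "'k::comm_semiring_1 mpoly"
  shows "f \<in> homog n e \<Longrightarrow> f ^ r \<in> homog n (r * e)"
  by (induction r) (auto intro: homog_1 homog_mult)

lemma homog_degree_unique: "f \<in> homog n e \<Longrightarrow> f \<in> homog n e' \<Longrightarrow> f \<noteq> 0 \<Longrightarrow> e = e'"
  unfolding homog_def by (auto simp flip: keys_eq_empty)

lemma minus_single_add_single:
  fixes s :: "nat \<Rightarrow>\<^sub>0 nat"
  assumes "N \<le> Poly_Mapping.lookup s i"
  shows "(s - Poly_Mapping.single i N) + Poly_Mapping.single i N = s"
  using assms by (intro poly_mapping_eqI) (auto simp: lookup_add lookup_minus lookup_single when_def)

lemma homog_partial_deriv:
  assumes "f \<in> homog n (Suc e)"
  shows "partial_deriv i f \<in> homog n e"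
  unfolding partial_deriv_def
proof (intro homog_sum homog_single conjI)
  fix s assume s: "s \<in> Poly_Mapping.keys f"
    and "of_nat (Poly_Mapping.lookup s i) * Poly_Mapping.lookup f s \<noteq> 0"
  then have "Poly_Mapping.lookup s i \<noteq> 0"
    by (metis mult_zero_left of_nat_0)
  then have eq: "(s - Poly_Mapping.single i 1) + Poly_Mapping.single i 1 = s"
    by (intro minus_single_add_single) simp
  show "monom_degree (s - Poly_Mapping.single i 1) = e"
    using homogD(2)[OF assms s] monom_degree_add[of "s - Poly_Mapping.single i 1" "Poly_Mapping.single i 1"]
    by (simp only: eq monom_degree_single)
  have "Poly_Mapping.keys (s - Poly_Mapping.single i 1) \<subseteq> Poly_Mapping.keys s"
    by (auto simp: in_keys_iff lookup_minus)
  then show "Poly_Mapping.keys (s - Poly_Mapping.single i 1) \<subseteq> {..n}"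
    using homogD(1)[OF assms s] by blast
qed

text \<open>The operator t_i d/dt_i multiplies a monomial by its i-th exponent, and the exponents
  add up to the degree.\<close>

lemma Euler_homog:
  assumes "f \<in> homog n e"
  shows "(\<Sum>i\<le>n. var i * partial_deriv i f) = of_nat e * f"
proof -
  have deriv_term: "var i * Poly_Mapping.single (s - Poly_Mapping.single i 1) (of_nat (Poly_Mapping.lookup s i) * c)
      = of_nat (Poly_Mapping.lookup s i) * Poly_Mapping.single s c" for i s and c :: 'a
  proof (cases "Poly_Mapping.lookup s i = 0")
    case False
    then have "Poly_Mapping.single i 1 + (s - Poly_Mapping.single i 1) = s"
      using minus_single_add_single[of 1 s i] by (simp add: add.commute)
    then show ?thesis
      by (simp add: var_def mult_single flip: single_of_nat)
  qed simp
  have "(\<Sum>i\<le>n. var i * partial_deriv i f)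
      = (\<Sum>i\<le>n. \<Sum>s\<in>Poly_Mapping.keys f. of_nat (Poly_Mapping.lookup s i)
        * Poly_Mapping.single s (Poly_Mapping.lookup f s))"
    unfolding partial_deriv_def sum_distrib_left deriv_term ..
  also have "\<dots> = (\<Sum>s\<in>Poly_Mapping.keys f. (\<Sum>i\<le>n. of_nat (Poly_Mapping.lookup s i))
        * Poly_Mapping.single s (Poly_Mapping.lookup f s))"
    unfolding sum_distrib_right by (rule sum.swap)
  also have "\<dots> = (\<Sum>s\<in>Poly_Mapping.keys f. of_nat e * Poly_Mapping.single s (Poly_Mapping.lookup f s))"
  proof (rule sum.cong)
    fix s assume s: "s \<in> Poly_Mapping.keys f"
    have "(\<Sum>i\<le>n. Poly_Mapping.lookup s i) = e"
      using monom_degree_superset[of "{..n}" s] homogD[OF assms s] by simp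
    then show "(\<Sum>i\<le>n. of_nat (Poly_Mapping.lookup s i)) * Poly_Mapping.single s (Poly_Mapping.lookup f s)
        = of_nat e * Poly_Mapping.single s (Poly_Mapping.lookup f s)"
      by (simp flip: of_nat_sum)
  qed simp
  also have "\<dots> = of_nat e * f"
    by (simp add: poly_mapping_expand flip: sum_distrib_left)
  finally show ?thesis .
qed

section \<open>Ideals generated by powers of the variables\<close>

lemma lookup_single_mult:
  fixes f :: "'k::comm_semiring_1 mpoly"
  shows "Poly_Mapping.lookup (Poly_Mapping.single k c * f) (k + s) = c * Poly_Mapping.lookup f s"
proof (induction f rule: poly_mapping_add_induct)
  case (single t d)
  then show ?case by (auto simp: mult_single lookup_single when_def)
qed (simp add: distrib_left lookup_add)

lemma var_power_dvd:
  fixes f :: "'k::comm_semiring_1 mpoly"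
  assumes "\<And>s. s \<in> Poly_Mapping.keys f \<Longrightarrow> N \<le> Poly_Mapping.lookup s i"
  shows "f = var i ^ N * (\<Sum>s\<in>Poly_Mapping.keys f.
    Poly_Mapping.single (s - Poly_Mapping.single i N) (Poly_Mapping.lookup f s))"
proof -
  have "f = (\<Sum>s\<in>Poly_Mapping.keys f. Poly_Mapping.single s (Poly_Mapping.lookup f s))"
    by (simp only: poly_mapping_expand)
  also have "\<dots> = (\<Sum>s\<in>Poly_Mapping.keys f.
      var i ^ N * Poly_Mapping.single (s - Poly_Mapping.single i N) (Poly_Mapping.lookup f s))"
  proof (rule sum.cong)
    fix s assume "s \<in> Poly_Mapping.keys f"
    then have "Poly_Mapping.single i N + (s - Poly_Mapping.single i N) = s"
      using minus_single_add_single[of N s i] assms by (simp add: add.commute)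
    then show "Poly_Mapping.single s (Poly_Mapping.lookup f s)
        = var i ^ N * Poly_Mapping.single (s - Poly_Mapping.single i N) (Poly_Mapping.lookup f s)"
      by (simp add: var_power mult_single)
  qed simp
  finally show ?thesis by (simp add: sum_distrib_left)
qed

text \<open>The ideal generated by the N-th powers of the first \<open>r\<close> variables. A
  monomial ideal is determined by its monomials, so the hypotheses of the Koszul argument become
  statements about exponents.\<close>

definition var_power_ideal :: "nat \<Rightarrow> nat \<Rightarrow> 'k::comm_ring_1 mpoly set" where
  "var_power_ideal N r = {f. \<forall>s\<in>Poly_Mapping.keys f. \<exists>j<r. N \<le> Poly_Mapping.lookup s j}"

lemma is_ideal_var_power_ideal: "is_ideal (var_power_ideal N r :: 'k::comm_ring_1 mpoly set)"
  unfolding is_ideal_def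
proof (intro conjI ballI allI)
  show "(0::'k mpoly) \<in> var_power_ideal N r"
    by (simp add: var_power_ideal_def)
next
  fix f g :: "'k mpoly"
  assume "f \<in> var_power_ideal N r" "g \<in> var_power_ideal N r"
  then show "f + g \<in> var_power_ideal N r"
    using keys_add[of f g] unfolding var_power_ideal_def by blast
next
  fix h f :: "'k mpoly"
  assume f: "f \<in> var_power_ideal N r"
  show "h * f \<in> var_power_ideal N r"
    unfolding var_power_ideal_def
  proof (intro CollectI ballI)
    fix s assume "s \<in> Poly_Mapping.keys (h * f)"
    then obtain a b where "s = a + b" "b \<in> Poly_Mapping.keys f"
      using keys_mult[of h f] by blast
    moreover from this obtain j where "j < r" "N \<le> Poly_Mapping.lookup b j"
      using f unfolding var_power_ideal_def by blast
    ultimately show "\<exists>j<r. N \<le> Poly_Mapping.lookup s j"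
      by (auto simp: lookup_add)
  qed
qed

lemma var_power_ideal_0: "var_power_ideal N 0 = {0}"
  by (auto simp: var_power_ideal_def)

text \<open>The monomials of \<open>f\<close> divisible by \<open>var r ^ N\<close> are collected in
  \<open>g\<close>; each of the others must be divisible by the power of an earlier
  variable.\<close>

lemma var_power_ideal_Suc:
  fixes f :: "'k::comm_ring_1 mpoly"
  shows "f \<in> var_power_ideal N (Suc r) \<longleftrightarrow> (\<exists>u. f - var r ^ N * u \<in> var_power_ideal N r)"
proof
  assume f: "f \<in> var_power_ideal N (Suc r)"
  let ?K = "{s \<in> Poly_Mapping.keys f. N \<le> Poly_Mapping.lookup s r}"
  define g where "g = (\<Sum>s\<in>?K. Poly_Mapping.single s (Poly_Mapping.lookup f s))"
  have lookup_g: "Poly_Mapping.lookup g s = (if N \<le> Poly_Mapping.lookup s r then Poly_Mapping.lookup f s else 0)" for s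
    by (simp add: g_def lookup_sum lookup_single when_def in_keys_iff)
  then have "Poly_Mapping.keys g \<subseteq> ?K"
    by (auto simp: in_keys_iff split: if_splits)
  then obtain u where "g = var r ^ N * u"
    using var_power_dvd[of g N r] by blast
  moreover have "f - g \<in> var_power_ideal N r"
    unfolding var_power_ideal_def
  proof (intro CollectI ballI)
    fix s assume "s \<in> Poly_Mapping.keys (f - g)"
    then have "s \<in> Poly_Mapping.keys f" "\<not> N \<le> Poly_Mapping.lookup s r"
      by (auto simp: in_keys_iff lookup_minus lookup_g split: if_splits)
    then show "\<exists>j<r. N \<le> Poly_Mapping.lookup s j"
      using f less_Suc_eq unfolding var_power_ideal_def by auto
  qed
  ultimately show "\<exists>u. f - var r ^ N * u \<in> var_power_ideal N r"
    by blast
next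
  note I = is_idealD[OF is_ideal_var_power_ideal[where 'k = 'k]]
  assume "\<exists>u. f - var r ^ N * u \<in> var_power_ideal N r"
  then obtain u where "f - var r ^ N * u \<in> var_power_ideal N (Suc r)"
    unfolding var_power_ideal_def using less_SucI by blast
  moreover have "var r ^ N \<in> (var_power_ideal N (Suc r) :: 'k mpoly set)"
    by (auto simp: var_power var_power_ideal_def)
  ultimately have "(f - var r ^ N * u) + var r ^ N * u \<in> var_power_ideal N (Suc r)"
    by (intro I(2) I(4))
  then show "f \<in> var_power_ideal N (Suc r)" by simp
qed

text \<open>Multiplication by a power of \<open>var r\<close> shifts the monomials injectively and
  leaves their exponents at all \<open>j < r\<close> unchanged.\<close>

lemma var_power_regular:
  fixes f :: "'k::comm_ring_1 mpoly"
  assumes "var r ^ N * f \<in> var_power_ideal N r"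
  shows "f \<in> var_power_ideal N r"
  unfolding var_power_ideal_def
proof (intro CollectI ballI)
  fix s assume "s \<in> Poly_Mapping.keys f"
  then have "Poly_Mapping.single r N + s \<in> Poly_Mapping.keys (var r ^ N * f)"
    by (simp add: in_keys_iff var_power lookup_single_mult)
  then obtain j where "j < r" "N \<le> Poly_Mapping.lookup (Poly_Mapping.single r N + s) j"
    using assms unfolding var_power_ideal_def by blast
  then show "\<exists>j<r. N \<le> Poly_Mapping.lookup s j"
    by (auto simp: lookup_add lookup_single when_def)
qed

section \<open>The projective Nullstellensatz and syzygies\<close>

definition ideal_gen :: "(nat \<Rightarrow> 'a::comm_ring_1) \<Rightarrow> nat set \<Rightarrow> 'a set" where
  "ideal_gen F N = {\<Sum>i\<in>N. c i * F i | c. True}"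

lemma ideal_gen_intro: "(\<Sum>i\<in>N. c i * F i) \<in> ideal_gen F N"
  by (auto simp: ideal_gen_def)

lemma is_ideal_ideal_gen: "is_ideal (ideal_gen F N)"
  unfolding is_ideal_def
proof (intro conjI ballI allI)
  show "0 \<in> ideal_gen F N"
    using ideal_gen_intro[of "\<lambda>_. 0" F N] by simp
next
  fix x y assume "x \<in> ideal_gen F N" "y \<in> ideal_gen F N"
  then obtain c d where "x = (\<Sum>i\<in>N. c i * F i)" "y = (\<Sum>i\<in>N. d i * F i)"
    by (auto simp: ideal_gen_def)
  then show "x + y \<in> ideal_gen F N"
    using ideal_gen_intro[of "\<lambda>i. c i + d i" F N] by (simp add: distrib_right sum.distrib)
next
  fix r x assume "x \<in> ideal_gen F N"
  then obtain c where "x = (\<Sum>i\<in>N. c i * F i)"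
    by (auto simp: ideal_gen_def)
  then show "r * x \<in> ideal_gen F N"
    using ideal_gen_intro[of "\<lambda>i. r * c i" F N] by (simp add: sum_distrib_left mult.assoc)
qed

lemma generator_in_ideal_gen:
  assumes "finite N" "i \<in> N"
  shows "F i \<in> ideal_gen F N"
proof -
  have "(\<Sum>l\<in>N. (if l = i then 1 else 0) * F l) = (\<Sum>l\<in>N. if l = i then F l else 0)"
    by (intro sum.cong) auto
  also have "\<dots> = F i" using assms by simp
  finally show ?thesis
    using ideal_gen_intro[of "\<lambda>l. if l = i then 1 else 0" F N] by simp
qed

text \<open>On polynomials of degree at most \<open>E\<close> this is homogenisation to degree \<open>E\<close> with respect
  to the variable \<open>t\<^sub>j\<close>, followed by identifying the homogenising variable with \<open>t\<^sub>j\<close>.\<close>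

definition homogenise :: "nat \<Rightarrow> nat \<Rightarrow> 'k::comm_ring_1 mpoly \<Rightarrow> 'k mpoly" where
  "homogenise j E f = (\<Sum>s\<in>Poly_Mapping.keys f.
     Poly_Mapping.single (s + Poly_Mapping.single j (E - monom_degree s)) (Poly_Mapping.lookup f s))"

lemma homogenise_superset:
  assumes "finite A" "Poly_Mapping.keys f \<subseteq> A"
  shows "homogenise j E f = (\<Sum>s\<in>A.
    Poly_Mapping.single (s + Poly_Mapping.single j (E - monom_degree s)) (Poly_Mapping.lookup f s))"
  unfolding homogenise_def using assms
  by (intro sum.mono_neutral_left) (auto simp: in_keys_iff)

lemma homogenise_add: "homogenise j E (f + g) = homogenise j E f + homogenise j E g"
proof -
  let ?A = "Poly_Mapping.keys f \<union> Poly_Mapping.keys g"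
  have "homogenise j E (f + g) = (\<Sum>s\<in>?A.
      Poly_Mapping.single (s + Poly_Mapping.single j (E - monom_degree s)) (Poly_Mapping.lookup (f + g) s))"
    by (intro homogenise_superset keys_add) simp
  then show ?thesis
    by (simp add: lookup_add single_add sum.distrib homogenise_superset[of ?A])
qed

lemma homogenise_single:
  "homogenise j E (Poly_Mapping.single s c) = Poly_Mapping.single (s + Poly_Mapping.single j (E - monom_degree s)) c"
  by (simp add: homogenise_def)

lemma homogenise_0: "homogenise j E 0 = 0"
  by (simp add: homogenise_def)

lemma homogenise_diff: "homogenise j E (f - g) = homogenise j E f - homogenise j E g"
  using homogenise_add[of j E "f - g" g] by simp

lemma homogenise_sum: "homogenise j E (\<Sum>i\<in>A. f i) = (\<Sum>i\<in>A. homogenise j E (f i))"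
  by (induction A rule: infinite_finite_induct) (simp_all add: homogenise_add homogenise_0)

text \<open>Truncated subtraction of a sum agrees with subtracting the summands in turn, so the
  padding exponents match for every \<open>E\<close>, even where they are cut off at 0.\<close>

lemma homogenise_mult_homog:
  fixes f :: "'k::comm_ring_1 mpoly"
  assumes "f \<in> homog n e"
  shows "homogenise j E (h * f) = homogenise j (E - e) h * f"
proof (induction h rule: poly_mapping_add_induct)
  case (single s c)
  have "Poly_Mapping.single s c * f
      = (\<Sum>u\<in>Poly_Mapping.keys f. Poly_Mapping.single s c * Poly_Mapping.single u (Poly_Mapping.lookup f u))"
    by (simp add: poly_mapping_expand flip: sum_distrib_left)
  also have "homogenise j E \<dots> = (\<Sum>u\<in>Poly_Mapping.keys f.
      homogenise j (E - e) (Poly_Mapping.single s c) * Poly_Mapping.single u (Poly_Mapping.lookup f u))"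
    unfolding homogenise_sum
  proof (rule sum.cong)
    fix u assume "u \<in> Poly_Mapping.keys f"
    then have "monom_degree u = e"
      by (rule homogD(2)[OF assms])
    then have "E - monom_degree (s + u) = E - e - monom_degree s"
      by (simp add: monom_degree_add)
    then show "homogenise j E (Poly_Mapping.single s c * Poly_Mapping.single u (Poly_Mapping.lookup f u))
        = homogenise j (E - e) (Poly_Mapping.single s c) * Poly_Mapping.single u (Poly_Mapping.lookup f u)"
      by (simp add: mult_single homogenise_single add_ac)
  qed simp
  also have "\<dots> = homogenise j (E - e) (Poly_Mapping.single s c) * f"
    by (simp add: poly_mapping_expand flip: sum_distrib_left)
  finally show ?case .
qed (simp add: distrib_right homogenise_add)

text \<open>The factor \<open>var j\<close> replaces one of the padding factors; the strict bound
  guarantees that there is one. Hence multiples of \<open>var j - 1\<close> are sent to 0 once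
  \<open>E\<close> is large.\<close>

lemma homogenise_mult_var:
  fixes g :: "'k::comm_ring_1 mpoly"
  assumes "\<And>s. s \<in> Poly_Mapping.keys g \<Longrightarrow> monom_degree s < E"
  shows "homogenise j E (g * var j) = homogenise j E g"
proof -
  have "g * var j
      = (\<Sum>s\<in>Poly_Mapping.keys g. Poly_Mapping.single s (Poly_Mapping.lookup g s) * var j)"
    by (simp add: poly_mapping_expand flip: sum_distrib_right)
  also have "homogenise j E \<dots> = homogenise j E g"
    unfolding homogenise_sum homogenise_def[of j E g]
  proof (rule sum.cong)
    fix s assume "s \<in> Poly_Mapping.keys g"
    then have "E - monom_degree s = Suc (E - Suc (monom_degree s))"
      using assms by (simp add: Suc_diff_Suc)
    then have "s + Poly_Mapping.single j 1 + Poly_Mapping.single j (E - Suc (monom_degree s))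
        = s + Poly_Mapping.single j (E - monom_degree s)"
      by (simp add: add.assoc flip: single_add)
    then show "homogenise j E (Poly_Mapping.single s (Poly_Mapping.lookup g s) * var j)
        = Poly_Mapping.single (s + Poly_Mapping.single j (E - monom_degree s)) (Poly_Mapping.lookup g s)"
      by (simp add: var_def mult_single homogenise_single monom_degree_add monom_degree_single)
  qed simp
  finally show ?thesis .
qed

text \<open>With the identity for \<open>h\<close> this rescales the coordinates at a place; with
  \<open>to_fract\<close> and the reciprocal of a coordinate it is dehomogenisation.\<close>

lemma subst_scaled_vars:
  fixes f :: "'k::comm_ring_1 mpoly" and h :: "'k mpoly \<Rightarrow> 'a::comm_ring_1"
  assumes f: "f \<in> homog n e"
    and h: "\<And>f g. h (f + g) = h f + h g" "\<And>f g. h (f * g) = h f * h g" "h 1 = 1"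
  shows "subst_poly (\<lambda>c. h (const_poly c)) (\<lambda>i. h (var i) * y) f = y ^ e * h f"
proof -
  have h_0: "h 0 = 0"
    using h(1)[of 0 0] by simp
  have h_sum: "h (\<Sum>i\<in>A. g i) = (\<Sum>i\<in>A. h (g i))" for g :: "(nat \<Rightarrow>\<^sub>0 nat) \<Rightarrow> 'k mpoly" and A
    by (induction A rule: infinite_finite_induct) (simp_all add: h h_0)
  have h_power: "h (g ^ k) = h g ^ k" for g k
    by (induction k) (simp_all add: h)
  have h_prod: "h (\<Prod>i\<in>A. g i) = (\<Prod>i\<in>A. h (g i))" for g :: "nat \<Rightarrow> 'k mpoly" and A
    by (induction A rule: infinite_finite_induct) (simp_all add: h)
  have "h (const_poly c) * monom_value (\<lambda>i. h (var i) * y) s = y ^ monom_degree s * h (Poly_Mapping.single s c)"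
    for s and c :: 'k
  proof -
    have "monom_value (\<lambda>i. h (var i) * y) s = h (Poly_Mapping.single s 1) * y ^ monom_degree s"
      unfolding monom_value_def monom_degree_def power_mult_distrib prod.distrib
        prod_var_power[symmetric] h_prod h_power
      by (simp add: power_sum)
    moreover have "Poly_Mapping.single s c = const_poly c * Poly_Mapping.single s 1"
      by (simp add: const_poly_def mult_single)
    ultimately show ?thesis
      by (simp only: h mult_ac)
  qed
  then have "subst_poly (\<lambda>c. h (const_poly c)) (\<lambda>i. h (var i) * y) f
      = (\<Sum>s\<in>Poly_Mapping.keys f. y ^ e * h (Poly_Mapping.single s (Poly_Mapping.lookup f s)))"
    unfolding subst_poly_def using homogD(2)[OF f] by (intro sum.cong) simp_all
  also have "\<dots> = y ^ e * h (\<Sum>s\<in>Poly_Mapping.keys f. Poly_Mapping.single s (Poly_Mapping.lookup f s))"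
    by (simp add: h_sum sum_distrib_left)
  finally show ?thesis
    by (simp only: poly_mapping_expand)
qed

text \<open>If no power of \<open>var j\<close> lies in the ideal of the forms, then adjoining
  \<open>var j - 1\<close> leaves it proper: homogenising an expression for 1 kills the multiple of
  \<open>var j - 1\<close> and turns 1 into a power of \<open>var j\<close>. In the residue field
  \<open>var j\<close> is then 1, so not all coordinates vanish there.\<close>

theorem projective_nullstellensatz:
  fixes F :: "nat \<Rightarrow> 'k::alg_closed_field mpoly"
  assumes F: "\<And>i. i \<in> A \<Longrightarrow> F i \<in> homog n e" and A: "finite A"
    and no_zero: "\<And>x. \<exists>i\<le>n. x i \<noteq> 0 \<Longrightarrow> \<exists>i\<in>A. eval_poly x (F i) \<noteq> 0"
    and j: "j \<le> n"
  shows "\<exists>N. var j ^ N \<in> ideal_gen F A"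
proof (rule ccontr)
  assume not_nilpotent: "\<nexists>N. var j ^ N \<in> ideal_gen F A"
  define X where "X = {f + g * (var j - 1) | f g. f \<in> ideal_gen F A}"
  note I = is_idealD[OF is_ideal_ideal_gen[of F A]]
  have X: "f + g * (var j - 1) \<in> X" if "f \<in> ideal_gen F A" for f g
    using that by (auto simp: X_def)
  have ideal_X: "is_ideal X"
    unfolding is_ideal_def
  proof (intro conjI ballI allI)
    show "0 \<in> X"
      using X[OF I(1), of 0] by simp
  next
    fix u v assume "u \<in> X" "v \<in> X"
    then obtain f g f' g' where fg: "u = f + g * (var j - 1)" "f \<in> ideal_gen F A"
      "v = f' + g' * (var j - 1)" "f' \<in> ideal_gen F A"
      unfolding X_def by blast
    have "u + v = (f + f') + (g + g') * (var j - 1)"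
      unfolding fg(1,3) by (simp add: algebra_simps)
    then show "u + v \<in> X"
      using X[OF I(2)[OF fg(2,4)]] by simp
  next
    fix r u assume "u \<in> X"
    then obtain f g where fg: "u = f + g * (var j - 1)" "f \<in> ideal_gen F A"
      unfolding X_def by blast
    have "r * u = r * f + (r * g) * (var j - 1)"
      unfolding fg(1) by (simp add: algebra_simps)
    then show "r * u \<in> X"
      using X[OF I(3)[OF fg(2)]] by simp
  qed
  have "1 \<notin> X"
  proof
    assume "1 \<in> X"
    then obtain c g where cg: "1 = (\<Sum>i\<in>A. c i * F i) + g * (var j - 1)"
      unfolding X_def ideal_gen_def by auto
    \<comment> \<open>\<open>E\<close> has to exceed the degrees occurring in \<open>g\<close>; the
      products \<open>c i * F i\<close> homogenise well for every \<open>E\<close>.\<close>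
    obtain E where "\<forall>s\<in>Poly_Mapping.keys g. monom_degree s < E"
      by (metis finite_imageI finite_keys finite_nat_set_iff_bounded image_eqI)
    then have "homogenise j E (g * (var j - 1)) = 0"
      by (simp add: algebra_simps homogenise_diff homogenise_mult_var)
    moreover have "homogenise j E (1 :: 'k mpoly) = var j ^ E"
      by (simp add: var_power homogenise_single monom_degree_def flip: single_one)
    ultimately have "var j ^ E = (\<Sum>i\<in>A. homogenise j (E - e) (c i) * F i)"
      using arg_cong[OF cg, of "homogenise j E"]
      by (simp add: homogenise_add homogenise_sum homogenise_mult_homog[OF F])
    then show False
      using not_nilpotent ideal_gen_intro by metis
  qed
  then obtain M where M: "is_ideal M" "1 \<notin> M" "X \<subseteq> M" "\<And>x. x \<notin> M \<Longrightarrow> \<exists>y. x * y - 1 \<in> M"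
    using exists_maximal_ideal[OF ideal_X] by metis
  interpret residue_algebra "const_poly :: 'k \<Rightarrow> 'k mpoly" M
    by unfold_locales (use M in \<open>simp_all add: const_poly_hom\<close>)
  have "var j - 1 \<in> M"
    using X[OF I(1), of 1] M(3) by auto
  then have "var j \<notin> M"
    using is_idealD(5)[OF M(1), of "var j" "var j - 1"] M(2) by auto
  then obtain G y x l where G: "place_graph const_poly M G" and l: "l \<le> n" "x l = 1"
    and x: "\<And>i. i \<le> n \<Longrightarrow> (var i * y, x i) \<in> G"
    using exists_place_point[of "{..n}" var] j by (metis atMost_iff finite_atMost)
  have "eval_poly x (F i) = 0" if i: "i \<in> A" for i
  proof -
    \<comment> \<open>The form at the rescaled coordinates has two values under the place: its value
      at \<open>x\<close>, and 0 because it equals \<open>y ^ e * F i\<close>, an element of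
      \<open>M\<close>.\<close>
    have "(subst_poly const_poly (\<lambda>i. var i * y) (F i), subst_poly (\<lambda>c. c) x (F i)) \<in> G"
      unfolding subst_poly_def monom_value_def
      using homogD(1)[OF F[OF i]]
      by (intro graph_sum[OF G] graph_intros(6)[OF G] graph_intros(1)[OF G] graph_prod[OF G]
          graph_power[OF G] x) blast
    moreover have "F i \<in> M"
      using X[OF generator_in_ideal_gen[OF A i], of 0] M(3) by auto
    then have "(subst_poly const_poly (\<lambda>i. var i * y) (F i), 0) \<in> G"
      unfolding subst_scaled_vars[OF F[OF i], where h = "\<lambda>f. f", OF refl refl refl]
      by (intro graph_intros(2)[OF G] is_idealD(3)[OF M(1)])
    ultimately show ?thesis
      unfolding eval_poly_conv_subst by (rule graph_fun[OF G])
  qed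
  moreover have "\<exists>i\<le>n. x i \<noteq> 0"
    using l by (intro exI[of _ l]) simp
  ultimately show False
    using no_zero by blast
qed

theorem syzygy_degree_ge:
  fixes F :: "nat \<Rightarrow> 'k::alg_closed_field mpoly"
  assumes F: "\<And>i. i \<le> n \<Longrightarrow> F i \<in> homog n e"
    and no_zero: "\<And>x. \<exists>i\<le>n. x i \<noteq> 0 \<Longrightarrow> \<exists>i\<le>n. eval_poly x (F i) \<noteq> 0"
    and syzygy: "(\<Sum>i\<le>n. F i * G i) = 0"
    and G: "i \<le> n" "G i \<in> homog n m" "G i \<noteq> 0"
  shows "e \<le> m"
proof -
  have "\<exists>N. var j ^ N \<in> ideal_gen F {..n}" if "j \<le> n" for j
    using that F no_zero by (intro projective_nullstellensatz[where e = e]) (auto simp: Bex_def)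
  then have "\<forall>j. \<exists>N. j \<le> n \<longrightarrow> var j ^ N \<in> ideal_gen F {..n}"
    by blast
  from choice[OF this] obtain N where N: "\<And>j. j \<le> n \<Longrightarrow> var j ^ N j \<in> ideal_gen F {..n}"
    by blast
  \<comment> \<open>A common exponent puts the powers of all variables into the ideal at
    once.\<close>
  define K where "K = Max (N ` {..n})"
  have "\<exists>c. var j ^ K = (\<Sum>i\<le>n. c i * F i)" if "j \<le> n" for j
  proof -
    have "N j \<le> K"
      unfolding K_def using that by simp
    then have "var j ^ K = var j ^ (K - N j) * (var j ^ N j :: 'k mpoly)"
      by (simp flip: power_add)
    then have "var j ^ K \<in> ideal_gen F {..n}"
      using is_idealD(3)[OF is_ideal_ideal_gen N[OF that]] by simp
    then show ?thesis
      by (auto simp: ideal_gen_def)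
  qed
  then have "\<forall>j. \<exists>c. j \<le> n \<longrightarrow> var j ^ K = (\<Sum>i\<le>n. c i * F i)"
    by blast
  from choice[OF this] obtain c where c: "\<And>j. j \<le> n \<Longrightarrow> var j ^ K = (\<Sum>i\<le>n. c j i * F i)"
    by blast
  have "\<exists>u. G i = (\<Sum>j\<in>{..n}. F j * u j)"
  proof (rule syzygy_in_ideal[where J = "var_power_ideal K" and a = "\<lambda>j. var j ^ K" and c = c])
    show "is_ideal (var_power_ideal K r :: 'k mpoly set)" for r
      by (rule is_ideal_var_power_ideal)
    show "var_power_ideal K 0 = ({0} :: 'k mpoly set)"
      by (rule var_power_ideal_0)
    show "f \<in> var_power_ideal K (Suc r) \<longleftrightarrow> (\<exists>u. f - var r ^ K * u \<in> var_power_ideal K r)"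
      for r and f :: "'k mpoly"
      by (rule var_power_ideal_Suc)
    show "f \<in> var_power_ideal K r" if "var r ^ K * f \<in> var_power_ideal K r" for r and f :: "'k mpoly"
      using that by (rule var_power_regular)
    show "var r ^ K = (\<Sum>i\<in>{..n}. c r i * F i)" if "r < card {..n}" for r
      using c that by simp
  qed (use G(1) syzygy in auto)
  then obtain u where u: "G i = (\<Sum>j\<le>n. F j * u j)"
    by blast
  \<comment> \<open>The \<open>u j\<close> may be inhomogeneous, so degrees are compared on a single
    monomial of \<open>G i\<close>, which is a multiple of a monomial of some
    \<open>F j\<close>.\<close>
  obtain s where s: "s \<in> Poly_Mapping.keys (G i)"
    using G(3) by (metis ex_in_conv keys_eq_empty)
  then obtain j where j: "j \<le> n" "s \<in> Poly_Mapping.keys (F j * u j)"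
    using keys_sum[of "\<lambda>j. F j * u j" "{..n}"] unfolding u by auto
  then obtain a b where "s = a + b" "a \<in> Poly_Mapping.keys (F j)"
    using keys_mult[of "F j" "u j"] by blast
  then show ?thesis
    using homogD(2)[OF F[OF j(1)]] homogD(2)[OF G(2) s] by (auto simp: monom_degree_add)
qed

section \<open>Vector fields\<close>

lemma to_fract_power: "to_fract (a ^ r) = to_fract a ^ r"
  by (induction r) simp_all

lemma to_fract_sum: "to_fract (\<Sum>i\<in>A. f i) = (\<Sum>i\<in>A. to_fract (f i))"
  by (induction A rule: infinite_finite_induct) simp_all

lemma to_fract_of_nat: "to_fract (of_nat k) = of_nat k"
  by (induction k) simp_all

lemma var_nonzero: "var i \<noteq> (0 :: 'k::comm_ring_1 mpoly)"
  by (simp add: var_def flip: keys_eq_empty)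

text \<open>A non-zero form has just one degree, so the degree quantified in the definition can be
  fixed.\<close>

lemma twist_sections_iff:
  assumes "f \<in> homog n e" "f \<noteq> 0"
  shows "u \<in> twist_sections n l f \<longleftrightarrow>
    (\<exists>a r d. a \<in> homog n d \<and> int d = l + int (r * e) \<and> u = to_fract a / to_fract f ^ r)"
  using assms homog_degree_unique[OF assms(1) _ assms(2)]
  unfolding twist_sections_def Fract_conv_to_fract to_fract_power by blast

context
  fixes f :: "'k::field mpoly" and n e :: nat
  assumes f: "f \<in> homog n e" "f \<noteq> 0"
begin

lemma twist_sections_poly: "a \<in> homog n d \<Longrightarrow> to_fract a \<in> twist_sections n (int d) f"
  unfolding twist_sections_iff[OF f] by (intro exI[of _ a] exI[of _ 0] exI[of _ d]) simp

lemma twist_sections_const: "to_fract (const_poly c) \<in> twist_sections n 0 f"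
  using twist_sections_poly[OF homog_const] by simp

lemma twist_sections_1: "1 \<in> twist_sections n 0 f"
  using twist_sections_const[of 1] by (simp add: const_poly_hom)

lemma twist_sections_0: "0 \<in> twist_sections n 0 f"
  using twist_sections_const[of 0] by (simp add: const_poly_hom)

lemma twist_sections_inverse: "1 / to_fract f \<in> twist_sections n (- int e) f"
  unfolding twist_sections_iff[OF f]
  by (intro exI[of _ 1] exI[of _ 1] exI[of _ 0]) (simp add: homog_1)

lemma twist_sections_mult:
  assumes "u \<in> twist_sections n l f" "v \<in> twist_sections n l' f"
  shows "u * v \<in> twist_sections n (l + l') f"
proof -
  obtain a r d b q d' where *: "a \<in> homog n d" "int d = l + int (r * e)" "u = to_fract a / to_fract f ^ r"
    "b \<in> homog n d'" "int d' = l' + int (q * e)" "v = to_fract b / to_fract f ^ q"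
    using assms unfolding twist_sections_iff[OF f] by blast
  have "int (d + d') = l + l' + int ((r + q) * e)"
    using * by (simp add: algebra_simps)
  moreover have "u * v = to_fract (a * b) / to_fract f ^ (r + q)"
    using * by (simp add: power_add)
  ultimately show ?thesis
    using homog_mult[OF *(1,4)]
    unfolding twist_sections_iff[OF f] by blast
qed

lemma twist_sections_add:
  assumes "u \<in> twist_sections n l f" "v \<in> twist_sections n l f"
  shows "u + v \<in> twist_sections n l f"
proof -
  obtain a r d b q d' where *: "a \<in> homog n d" "int d = l + int (r * e)" "u = to_fract a / to_fract f ^ r"
    "b \<in> homog n d'" "int d' = l + int (q * e)" "v = to_fract b / to_fract f ^ q"
    using assms unfolding twist_sections_iff[OF f] by blast
  then have "int (d + q * e) = int (d' + r * e)"
    by simp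
  then have "d + q * e = d' + r * e"
    unfolding of_nat_eq_iff .
  then have "a * f ^ q + b * f ^ r \<in> homog n (d + q * e)"
    using homog_mult[OF *(1) homog_power[OF f(1), of q]] homog_mult[OF *(4) homog_power[OF f(1), of r]]
    by (auto intro: homog_add)
  moreover have "int (d + q * e) = l + int ((r + q) * e)"
    using * by (simp add: algebra_simps)
  moreover have "u + v = to_fract (a * f ^ q + b * f ^ r) / to_fract f ^ (r + q)"
    unfolding *(3,6) using f(2) by (simp add: to_fract_power power_add add_frac_eq mult_ac)
  ultimately show ?thesis
    unfolding twist_sections_iff[OF f] by blast
qed

lemma twist_sections_scale:
  assumes "u \<in> twist_sections n l f"
  shows "to_fract (const_poly c) * u \<in> twist_sections n l f"
  using twist_sections_mult[OF twist_sections_const assms] by simp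

lemma twist_sections_diff:
  assumes "u \<in> twist_sections n l f" "v \<in> twist_sections n l f"
  shows "u - v \<in> twist_sections n l f"
proof -
  have "const_poly (-1) + 1 = (0 :: 'k mpoly)"
    using const_poly_hom(1)[of "-1" "1 :: 'k"] by (simp add: const_poly_hom)
  then have "to_fract (const_poly (-1)) = (-1 :: 'k mpoly fract)"
    by (metis eq_neg_iff_add_eq_0 to_fract_1 to_fract_uminus)
  then show ?thesis
    using twist_sections_add[OF assms(1) twist_sections_scale[OF assms(2), of "-1"]] by simp
qed

lemma twist_sections_power:
  assumes "u \<in> twist_sections n 0 f"
  shows "u ^ k \<in> twist_sections n 0 f"
  using assms twist_sections_mult[of _ 0 _ 0] by (induction k) (auto simp: twist_sections_1)

lemma twist_sections_sum:
  assumes "\<And>i. i \<in> A \<Longrightarrow> u i \<in> twist_sections n 0 f"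
  shows "(\<Sum>i\<in>A. u i) \<in> twist_sections n 0 f"
  using assms
  by (induction A rule: infinite_finite_induct) (auto intro: twist_sections_add twist_sections_0)

lemma twist_sections_prod:
  assumes "\<And>i. i \<in> A \<Longrightarrow> u i \<in> twist_sections n 0 f"
  shows "(\<Prod>i\<in>A. u i) \<in> twist_sections n 0 f"
  using assms twist_sections_mult[of _ 0 _ 0]
  by (induction A rule: infinite_finite_induct) (auto intro: twist_sections_1)

lemma twist_sections_restrict:
  assumes g: "g \<in> homog n e'" "g \<noteq> 0" and u: "u \<in> twist_sections n l f"
  shows "u \<in> twist_sections n l (f * g)"
proof -
  obtain a r d where *: "a \<in> homog n d" "int d = l + int (r * e)" "u = to_fract a / to_fract f ^ r"
    using u unfolding twist_sections_iff[OF f] by blast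
  have fg: "f * g \<in> homog n (e + e')" "f * g \<noteq> 0"
    using f g by (auto intro: homog_mult)
  show ?thesis
    unfolding twist_sections_iff[OF fg]
  proof (intro exI conjI)
    show "a * g ^ r \<in> homog n (d + r * e')"
      by (intro homog_mult homog_power * g)
    show "int (d + r * e') = l + int (r * (e + e'))"
      using * by (simp add: algebra_simps)
    show "u = to_fract (a * g ^ r) / to_fract (f * g) ^ r"
      using * g(2) by (simp add: to_fract_power power_mult_distrib)
  qed
qed

end

abbreviation coord :: "nat \<Rightarrow> 'k::field mpoly fract" where
  "coord i \<equiv> to_fract (var i)"

abbreviation fract_const :: "'k::field \<Rightarrow> 'k mpoly fract" where
  "fract_const c \<equiv> to_fract (const_poly c)"

lemma fract_const_hom:
  fixes c d :: "'k::field"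
  shows "fract_const (c + d) = fract_const c + fract_const d"
    "fract_const (c * d) = fract_const c * fract_const d"
    "fract_const (0::'k) = 0" "fract_const (1::'k) = 1"
  by (simp_all add: const_poly_hom)

lemma fract_const_of_nat: "fract_const (of_nat k :: 'k::field) = of_nat k"
  by (induction k) (simp_all add: fract_const_hom)

lemma basic_open_var: "i \<le> n \<Longrightarrow> basic_open n (var i :: 'k::field mpoly)"
  unfolding basic_open_def by (intro conjI exI[of _ 1] var_nonzero homog_var) simp_all

lemma basic_open_mult:
  fixes f g :: "'k::field mpoly"
  assumes "basic_open n f" "basic_open n g"
  shows "basic_open n (f * g)"
proof -
  obtain e e' where "f \<in> homog n e" "g \<in> homog n e'" "e > 0"
    using assms unfolding basic_open_def by blast
  then have "f * g \<in> homog n (e + e')" "e + e' > 0"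
    by (simp_all add: homog_mult)
  moreover have "f * g \<noteq> 0"
    using assms by (simp add: basic_open_def)
  ultimately show ?thesis
    unfolding basic_open_def by blast
qed

lemma coord_nonzero: "coord i \<noteq> 0"
  by (simp add: var_nonzero)

lemma coord_ratio_section:
  assumes "i \<le> n" "j \<le> n"
  shows "coord i / coord j \<in> twist_sections n 0 (var j :: 'k::field mpoly)"
proof -
  note tj = homog_var[OF assms(2)] var_nonzero
  show ?thesis
    using twist_sections_mult[OF tj twist_sections_poly[OF tj homog_var[OF assms(1)]]
        twist_sections_inverse[OF tj]]
    by simp
qed

lemma homog_ratio_section:
  assumes "g \<in> homog n e" "j \<le> n"
  shows "to_fract g / coord j ^ e \<in> twist_sections n 0 (var j)"
  unfolding twist_sections_iff[OF homog_var[OF assms(2)] var_nonzero]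
  using assms(1) by (intro exI[of _ g] exI[of _ e]) auto

lemma dehomogenise:
  fixes g :: "'k::field mpoly"
  assumes "g \<in> homog n e"
  shows "subst_poly fract_const (\<lambda>i. coord i / coord j) g = to_fract g / coord j ^ e"
  using subst_scaled_vars[OF assms, of to_fract "1 / coord j"]
  by (simp add: divide_simps)

text \<open>Comparing the two fractions gives \<open>var j ^ q * a = var i ^ r * b\<close>.
  Multiplication by \<open>var j ^ q\<close> does not touch the exponent of \<open>var i\<close>, so
  \<open>var i ^ r\<close> divides every monomial of \<open>a\<close>. Geometrically, the two charts
  miss only a set of codimension two.\<close>

lemma section_extends:
  fixes u :: "'k::field mpoly fract"
  assumes ij: "i \<noteq> j" "i \<le> n" "j \<le> n"
    and u: "u \<in> twist_sections n (int m) (var i)" "u \<in> twist_sections n (int m) (var j)"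
  shows "\<exists>q\<in>homog n m. u = to_fract q"
proof -
  obtain a r d where a: "a \<in> homog n d" "int d = int m + int (r * 1)" "u = to_fract a / coord i ^ r"
    using u(1) unfolding twist_sections_iff[OF homog_var[OF ij(2)] var_nonzero] by blast
  obtain b q where b: "u = to_fract b / coord j ^ q"
    using u(2) unfolding twist_sections_iff[OF homog_var[OF ij(3)] var_nonzero] by blast
  have "to_fract (var j ^ q * a) = to_fract (var i ^ r * b)"
    using a(3) b by (simp add: to_fract_power field_simps var_nonzero)
  then have eq: "var j ^ q * a = var i ^ r * b"
    by (simp only: to_fract_eq_iff)
  have r: "r \<le> Poly_Mapping.lookup s i" if s: "s \<in> Poly_Mapping.keys a" for s
  proof -
    have "Poly_Mapping.single j q + s \<in> Poly_Mapping.keys (var j ^ q * a)"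
      using s by (simp add: in_keys_iff var_power lookup_single_mult)
    then obtain t where "Poly_Mapping.single j q + s = Poly_Mapping.single i r + t"
      unfolding eq using keys_mult[of "var i ^ r" b] by (auto simp: var_power)
    then have "Poly_Mapping.lookup (Poly_Mapping.single j q + s) i
        = Poly_Mapping.lookup (Poly_Mapping.single i r + t) i"
      by simp
    then show ?thesis
      using ij(1) by (simp add: lookup_add lookup_single)
  qed
  define a' where "a' = (\<Sum>s\<in>Poly_Mapping.keys a.
    Poly_Mapping.single (s - Poly_Mapping.single i r) (Poly_Mapping.lookup a s))"
  have "a = var i ^ r * a'"
    unfolding a'_def by (rule var_power_dvd) (rule r)
  then have "u = to_fract a'"
    using a(3) by (simp add: to_fract_power var_nonzero)
  moreover have "a' \<in> homog n m"
    unfolding a'_def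
  proof (intro homog_sum homog_single conjI)
    fix s assume s: "s \<in> Poly_Mapping.keys a"
    have "monom_degree (s - Poly_Mapping.single i r) + r = d"
      using monom_degree_add[of "s - Poly_Mapping.single i r" "Poly_Mapping.single i r"]
        homogD(2)[OF a(1) s]
      by (simp only: minus_single_add_single[OF r[OF s]] monom_degree_single)
    then show "monom_degree (s - Poly_Mapping.single i r) = m"
      using a(2) by simp
    have "Poly_Mapping.keys (s - Poly_Mapping.single i r) \<subseteq> Poly_Mapping.keys s"
      by (auto simp: in_keys_iff lookup_minus)
    then show "Poly_Mapping.keys (s - Poly_Mapping.single i r) \<subseteq> {..n}"
      using homogD(1)[OF a(1) s] by blast
  qed
  ultimately show ?thesis by blast
qed

section \<open>Derivations of the structure sheaf and the chain rule\<close>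

locale vector_field =
  fixes n m :: nat and X :: "'k::field mpoly fract \<Rightarrow> 'k mpoly fract"
  assumes X: "is_vector_field n m X"
begin

context
  fixes f :: "'k mpoly" assumes open_f: "basic_open n f"
begin

lemma X_section: "u \<in> twist_sections n 0 f \<Longrightarrow> X u \<in> twist_sections n (int m - 1) f"
  and X_add: "u \<in> twist_sections n 0 f \<Longrightarrow> v \<in> twist_sections n 0 f \<Longrightarrow> X (u + v) = X u + X v"
  and X_mult: "u \<in> twist_sections n 0 f \<Longrightarrow> v \<in> twist_sections n 0 f \<Longrightarrow> X (u * v) = u * X v + v * X u"
  and X_scale: "u \<in> twist_sections n 0 f \<Longrightarrow> X (fract_const c * u) = fract_const c * X u"
  using X open_f unfolding is_vector_field_def to_fract_def by blast+

lemma open_f_homog: obtains e where "f \<in> homog n e" "f \<noteq> 0"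
  using open_f unfolding basic_open_def by blast

lemma X_0: "X 0 = 0" and X_1: "X 1 = 0"
proof -
  obtain e where f: "f \<in> homog n e" "f \<noteq> 0"
    by (rule open_f_homog)
  show "X 0 = 0"
    using X_scale[OF twist_sections_0[OF f], of 0] by (simp add: const_poly_hom)
  have "X 1 = X 1 + X 1"
    using X_mult[OF twist_sections_1[OF f] twist_sections_1[OF f]] by (simp only: mult_1)
  then show "X 1 = 0"
    by (simp only: add_cancel_right_right)
qed

lemma X_sum:
  assumes "\<And>i. i \<in> A \<Longrightarrow> u i \<in> twist_sections n 0 f"
  shows "X (\<Sum>i\<in>A. u i) = (\<Sum>i\<in>A. X (u i))"
proof -
  obtain e where f: "f \<in> homog n e" "f \<noteq> 0"
    by (rule open_f_homog)
  show ?thesis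
    using assms
    by (induction A rule: infinite_finite_induct) (auto simp: X_0 X_add twist_sections_sum[OF f])
qed

lemma X_power:
  assumes "u \<in> twist_sections n 0 f"
  shows "X (u ^ Suc k) = of_nat (Suc k) * u ^ k * X u"
proof (induction k)
  case (Suc k)
  obtain e where f: "f \<in> homog n e" "f \<noteq> 0"
    by (rule open_f_homog)
  have "X (u ^ Suc (Suc k)) = u * X (u ^ Suc k) + u ^ Suc k * X u"
    using X_mult[OF assms twist_sections_power[OF f assms, of "Suc k"]] by simp
  then show ?case
    unfolding Suc by (simp add: algebra_simps)
qed simp

context
  fixes u :: "nat \<Rightarrow> 'k mpoly fract"
  assumes u: "\<And>i. i \<le> n \<Longrightarrow> u i \<in> twist_sections n 0 f"
begin

lemma monom_value_section:
  assumes "Poly_Mapping.keys s \<subseteq> {..n}"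
  shows "monom_value u s \<in> twist_sections n 0 f"
proof -
  obtain e where f: "f \<in> homog n e" "f \<noteq> 0"
    by (rule open_f_homog)
  show ?thesis
    unfolding monom_value_def using assms
    by (intro twist_sections_prod[OF f] twist_sections_power[OF f] u) blast
qed

text \<open>Induction on the degree, splitting off one variable with the product rule. Where the
  truncated exponent \<open>s - Poly_Mapping.single l 1\<close> is not the true quotient, its
  coefficient is 0.\<close>

lemma X_monom_value:
  assumes "Poly_Mapping.keys s \<subseteq> {..n}"
  shows "X (monom_value u s)
    = (\<Sum>l\<le>n. of_nat (Poly_Mapping.lookup s l) * monom_value u (s - Poly_Mapping.single l 1) * X (u l))"
  using assms
proof (induction "monom_degree s" arbitrary: s)
  case 0
  then have "Poly_Mapping.lookup s l = 0" for l
    by (auto simp: monom_degree_def in_keys_iff)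
  then have "s = 0"
    by (intro poly_mapping_eqI) simp
  then show ?case
    by (simp add: monom_value_def X_1)
next
  case (Suc k)
  then obtain i where i: "i \<in> Poly_Mapping.keys s"
    by (metis Zero_not_Suc equals0I keys_eq_empty monom_degree_def sum.empty)
  define s' where "s' = s - Poly_Mapping.single i 1"
  have s: "s = s' + Poly_Mapping.single i 1"
    unfolding s'_def using i by (subst minus_single_add_single) (auto simp: in_keys_iff)
  have "Poly_Mapping.keys s' \<subseteq> Poly_Mapping.keys s"
    by (auto simp: s'_def in_keys_iff lookup_minus)
  then have s': "Poly_Mapping.keys s' \<subseteq> {..n}" and "i \<le> n"
    using Suc.prems i by auto
  have "monom_degree s' = k"
    using Suc.hyps(2) by (simp add: s monom_degree_add monom_degree_single)
  note IH = Suc.hyps(1)[OF this[symmetric] s']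
  have "of_nat (Poly_Mapping.lookup s l) * monom_value u (s - Poly_Mapping.single l 1)
      = (if l = i then monom_value u s' else 0)
        + u i * (of_nat (Poly_Mapping.lookup s' l) * monom_value u (s' - Poly_Mapping.single l 1))" for l
  proof (cases "Poly_Mapping.lookup s' l = 0")
    case True
    then show ?thesis
      by (auto simp: s lookup_add lookup_single when_def)
  next
    case False
    then have "s - Poly_Mapping.single l 1 = (s' - Poly_Mapping.single l 1) + Poly_Mapping.single i 1"
      unfolding s by (intro poly_mapping_eqI) (auto simp: lookup_add lookup_minus lookup_single when_def)
    moreover have "monom_value u s' = monom_value u (s' - Poly_Mapping.single l 1) * u l"
      using False minus_single_add_single[of 1 s' l]
      by (metis One_nat_def monom_value_add monom_value_single not_less_eq_eq le_zero_eq power_one_right)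
    ultimately show ?thesis
      by (simp add: s lookup_add lookup_single when_def monom_value_add monom_value_single algebra_simps)
  qed
  then have "(\<Sum>l\<le>n. of_nat (Poly_Mapping.lookup s l) * monom_value u (s - Poly_Mapping.single l 1) * X (u l))
      = (\<Sum>l\<le>n. (if l = i then monom_value u s' * X (u l) else 0)
        + u i * (of_nat (Poly_Mapping.lookup s' l) * monom_value u (s' - Poly_Mapping.single l 1) * X (u l)))"
    by (intro sum.cong) (simp_all add: algebra_simps)
  also have "\<dots> = monom_value u s' * X (u i) + u i * X (monom_value u s')"
    using \<open>i \<le> n\<close> by (simp add: IH sum.distrib sum_distrib_left)
  also have "\<dots> = X (monom_value u s' * u i)"
    using X_mult[OF monom_value_section[OF s'] u[OF \<open>i \<le> n\<close>]] by simp
  also have "monom_value u s' * u i = monom_value u s"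
    by (simp add: s monom_value_add monom_value_single)
  finally show ?case by simp
qed

lemma X_subst:
  assumes g: "g \<in> homog n e"
  shows "X (subst_poly fract_const u g)
    = (\<Sum>i\<le>n. subst_poly fract_const u (partial_deriv i g) * X (u i))"
proof -
  obtain e' where f: "f \<in> homog n e'" "f \<noteq> 0"
    by (rule open_f_homog)
  have "X (subst_poly fract_const u g)
      = (\<Sum>s\<in>Poly_Mapping.keys g. fract_const (Poly_Mapping.lookup g s) * X (monom_value u s))"
    unfolding subst_poly_def using homogD(1)[OF g]
    by (subst X_sum) (simp_all add: X_scale monom_value_section twist_sections_scale[OF f])
  also have "\<dots> = (\<Sum>s\<in>Poly_Mapping.keys g. \<Sum>i\<le>n.
      fract_const (of_nat (Poly_Mapping.lookup s i) * Poly_Mapping.lookup g s)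
      * monom_value u (s - Poly_Mapping.single i 1) * X (u i))"
    using homogD(1)[OF g]
    by (intro sum.cong refl)
      (simp add: X_monom_value sum_distrib_left fract_const_hom(2) fract_const_of_nat mult_ac del: to_fract_mult)
  also have "\<dots> = (\<Sum>i\<le>n. \<Sum>s\<in>Poly_Mapping.keys g.
      fract_const (of_nat (Poly_Mapping.lookup s i) * Poly_Mapping.lookup g s)
      * monom_value u (s - Poly_Mapping.single i 1) * X (u i))"
    by (rule sum.swap)
  also have "\<dots> = (\<Sum>i\<le>n. subst_poly fract_const u (partial_deriv i g) * X (u i))"
    unfolding partial_deriv_def subst_poly_sum[OF fract_const_hom] subst_poly_single[OF fract_const_hom]
      sum_distrib_right ..
  finally show ?thesis .
qed

end

end

lemma X_homog_ratio:
  assumes g: "g \<in> homog n (Suc e)" and j: "j \<le> n"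
  shows "X (to_fract g / coord j ^ Suc e)
    = (\<Sum>i\<le>n. to_fract (partial_deriv i g) / coord j ^ e * X (coord i / coord j))"
proof -
  have "X (subst_poly fract_const (\<lambda>i. coord i / coord j) g)
    = (\<Sum>i\<le>n. subst_poly fract_const (\<lambda>i. coord i / coord j) (partial_deriv i g) * X (coord i / coord j))"
    by (rule X_subst[OF basic_open_var[OF j] coord_ratio_section[OF _ j] g])
  then show ?thesis
    by (simp only: dehomogenise[OF g] dehomogenise[OF homog_partial_deriv[OF g]])
qed

text \<open>By the chain rule \<open>X\<close> kills all polynomials in the ratios of coordinates to
  \<open>coord 0\<close>. A section \<open>u\<close> over any basic open set becomes such a
  polynomial after multiplication by a suitable \<open>w\<close>, itself of this kind; on the
  overlap the product rule leaves \<open>w * X u = 0\<close>, and \<open>w\<close> is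
  non-zero.\<close>

lemma X_zero:
  assumes "\<And>i. i \<le> n \<Longrightarrow> X (coord i / coord 0) = 0"
  shows "\<not> nonzero_vector_field n X"
proof -
  have zero: "X (to_fract g / coord 0 ^ e) = 0" if g: "g \<in> homog n e" for g e
  proof -
    have "X (subst_poly fract_const (\<lambda>i. coord i / coord 0) g)
      = (\<Sum>i\<le>n. subst_poly fract_const (\<lambda>i. coord i / coord 0) (partial_deriv i g) * X (coord i / coord 0))"
      by (rule X_subst[OF basic_open_var[of 0] coord_ratio_section g]) simp_all
    then show ?thesis
      using assms by (simp add: dehomogenise[OF g])
  qed
  have "X u = 0" if f: "basic_open n f" and u: "u \<in> twist_sections n 0 f" for f u
  proof -
    obtain e where e: "f \<in> homog n e" "f \<noteq> 0"
      using f unfolding basic_open_def by blast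
    obtain a r d where "a \<in> homog n d" "int d = 0 + int (r * e)"
      and a_eq: "u = to_fract a / to_fract f ^ r"
      using u unfolding twist_sections_iff[OF e] by blast
    then have a: "a \<in> homog n (r * e)"
      by (simp only: add_0 of_nat_eq_iff)
    define w where "w = to_fract (f ^ r) / coord 0 ^ (r * e)"
    have "u \<in> twist_sections n 0 (f * var 0)"
      by (rule twist_sections_restrict[OF e homog_var var_nonzero u]) simp
    moreover have "w \<in> twist_sections n 0 (var 0)"
      unfolding w_def by (rule homog_ratio_section[OF homog_power[OF e(1)]]) simp
    then have "w \<in> twist_sections n 0 (var 0 * f)"
      by (rule twist_sections_restrict[OF homog_var[OF le0] var_nonzero e])
    then have "w \<in> twist_sections n 0 (f * var 0)"
      by (simp only: mult.commute)
    ultimately have "X (u * w) = u * X w + w * X u"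
      using basic_open_mult[OF f basic_open_var] by (intro X_mult) auto
    moreover have "X w = 0"
      unfolding w_def by (rule zero[OF homog_power[OF e(1)]])
    moreover have "u * w = to_fract a / coord 0 ^ (r * e)"
      using e(2) by (simp add: a_eq w_def to_fract_power)
    then have "X (u * w) = 0"
      using zero[OF a] by simp
    moreover have "w \<noteq> 0"
      using e(2) by (simp add: w_def to_fract_power var_nonzero)
    ultimately show ?thesis by simp
  qed
  then show ?thesis
    unfolding nonzero_vector_field_def by blast
qed

end

section \<open>The lift that annihilates the equation\<close>

locale invariant_hypersurface = vector_field n m X
  for n m :: nat and X :: "'k::field mpoly fract \<Rightarrow> 'k mpoly fract" +
  fixes d :: nat and F :: "'k mpoly"
  assumes F: "F \<in> homog n d" "F \<noteq> 0"
    and invariant: "leaves_invariant n m X d F"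
    and d_nonzero: "(of_nat d :: 'k) \<noteq> 0"
begin

text \<open>In chart \<open>j\<close>, the lift with components
  \<open>coord j * X (coord i / coord j)\<close> has zero j-th component and sends F to P F with P
  equal to \<open>coord j ^ d * cofactor j\<close>. Invariance is what makes this quotient by F a
  section over the chart.\<close>

definition cofactor :: "nat \<Rightarrow> 'k mpoly fract" where
  "cofactor j = X (to_fract F / coord j ^ d) / to_fract F"

lemma X_equation: "X (to_fract F / coord j ^ d) = to_fract F * cofactor j"
  using F(2) by (simp add: cofactor_def)

lemma cofactor_section:
  assumes j: "j \<le> n"
  shows "cofactor j \<in> twist_sections n (int m - 1 - int d) (var j)"
proof -
  have "1 / coord j ^ d \<in> twist_sections n (0 - int d) (var j)"
    unfolding twist_sections_iff[OF homog_var[OF j] var_nonzero]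
    by (intro exI[of _ 1] exI[of _ d] exI[of _ 0]) (simp add: homog_1)
  then have "to_fract F * (1 / coord j ^ d) \<in> ideal_sections n d F 0 (var j)"
    unfolding ideal_sections_def to_fract_def[of F] by (rule imageI)
  then have "to_fract F / coord j ^ d \<in> ideal_sections n d F 0 (var j)"
    by simp
  then have "X (to_fract F / coord j ^ d) \<in> ideal_sections n d F (int m - 1) (var j)"
    using invariant basic_open_var[OF j] unfolding leaves_invariant_def by blast
  then show ?thesis
    unfolding ideal_sections_def cofactor_def to_fract_def[of F, symmetric] using F(2) by auto
qed

lemma of_nat_d_nonzero: "(of_nat d :: 'k mpoly fract) \<noteq> 0"
proof -
  have "const_poly (of_nat d :: 'k) \<noteq> 0"
    using d_nonzero by (metis const_poly_def lookup_single_eq lookup_zero)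
  then show ?thesis
    using to_fract_eq_0_iff[of "const_poly (of_nat d :: 'k)"]
    by (simp only: fract_const_of_nat simp_thms)
qed

text \<open>The \<open>i\<close>-th component of the unique homogeneous vector field on affine space that induces
  \<open>X\<close> and annihilates \<open>F\<close>, computed in the chart \<open>t\<^sub>j \<noteq> 0\<close>. It exists because \<open>d\<close> is
  invertible: this allows to subtract a multiple of the radial field.\<close>

definition lift :: "nat \<Rightarrow> nat \<Rightarrow> 'k mpoly fract" where
  "lift j i = coord j * X (coord i / coord j) - coord i * coord j ^ d * cofactor j / of_nat d"

lemma lift_section:
  assumes "i \<le> n" "j \<le> n"
  shows "lift j i \<in> twist_sections n (int m) (var j)"
proof -
  note tj = homog_var[OF assms(2)] var_nonzero
  note mult = twist_sections_mult[OF tj]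
  have coord_i: "coord i \<in> twist_sections n 1 (var j)" and coord_j: "coord j \<in> twist_sections n 1 (var j)"
    using twist_sections_poly[OF tj homog_var] assms by auto
  have coord_j_d: "coord j ^ d \<in> twist_sections n (int d) (var j)"
    using twist_sections_poly[OF tj homog_power[OF tj(1), of d]] by (simp add: to_fract_power)
  have "coord j * X (coord i / coord j) \<in> twist_sections n (1 + (int m - 1)) (var j)"
    using assms by (intro mult coord_j X_section basic_open_var coord_ratio_section)
  moreover have "fract_const (inverse (of_nat d)) * (coord i * coord j ^ d * cofactor j)
      \<in> twist_sections n (1 + int d + (int m - 1 - int d)) (var j)"
    using assms by (intro twist_sections_scale[OF tj] mult coord_i coord_j_d cofactor_section)
  moreover have "fract_const (inverse (of_nat d)) = (1 / of_nat d :: 'k mpoly fract)"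
    using fract_const_hom(2)[of "of_nat d" "inverse (of_nat d) :: 'k"] d_nonzero of_nat_d_nonzero
    by (simp add: fract_const_of_nat fract_const_hom field_simps del: to_fract_mult)
  ultimately show ?thesis
    unfolding lift_def using twist_sections_diff[OF tj] by simp
qed

text \<open>Passing from chart \<open>l\<close> to chart \<open>j\<close> changes both terms of the
  lift by \<open>coord i * (coord j / coord l) * X y\<close>. In the first term this comes from the
  product rule; in the second from the derivative of \<open>y ^ d\<close>, whose factor d cancels
  the division by d.\<close>

lemma lift_independent:
  assumes i: "i \<le> n" and j: "j \<le> n" and l: "l \<le> n"
  shows "lift j i = lift l i"
proof -
  define y where "y = (coord l / coord j :: 'k mpoly fract)"
  have nz: "coord a \<noteq> (0 :: 'k mpoly fract)" for a
    by (rule coord_nonzero)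
  have op: "basic_open n (var j * var l :: 'k mpoly)"
    using j l by (intro basic_open_mult basic_open_var)
  have restrict: "u \<in> twist_sections n 0 (var j * var l)"
    if "u \<in> twist_sections n 0 (var j) \<or> u \<in> twist_sections n 0 (var l)" for u :: "'k mpoly fract"
    using that twist_sections_restrict[OF homog_var[OF j] var_nonzero homog_var[OF l] var_nonzero]
      twist_sections_restrict[OF homog_var[OF l] var_nonzero homog_var[OF j] var_nonzero]
    by (auto simp: mult.commute)
  have y: "y \<in> twist_sections n 0 (var j * var l)"
    unfolding y_def by (rule restrict, rule disjI1, rule coord_ratio_section[OF l j])
  have il: "coord i / coord l \<in> twist_sections n 0 (var j * var l :: 'k mpoly)"
    by (rule restrict, rule disjI2, rule coord_ratio_section[OF i l])
  have Fl: "to_fract F / coord l ^ d \<in> twist_sections n 0 (var j * var l)"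
    by (rule restrict, rule disjI2, rule homog_ratio_section[OF F(1) l])
  obtain d' where d': "d = Suc d'"
    using d_nonzero by (cases d) auto
  have yd: "y ^ d \<in> twist_sections n 0 (var j * var l)"
    using twist_sections_power[OF homog_mult[OF homog_var[OF j] homog_var[OF l]] _ y] by (simp add: var_nonzero)
  have "coord i / coord j = coord i / coord l * y"
    using nz by (simp add: y_def)
  then have 1: "X (coord i / coord j) = coord i / coord l * X y + y * X (coord i / coord l)"
    using X_mult[OF op il y] by simp
  have "to_fract F / coord j ^ d = to_fract F / coord l ^ d * y ^ d"
    using nz by (simp add: y_def power_divide)
  then have "to_fract F * cofactor j
      = to_fract F / coord l ^ d * X (y ^ d) + y ^ d * (to_fract F * cofactor l)"
    using X_mult[OF op Fl yd] by (simp flip: X_equation)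
  also have "\<dots> = to_fract F * (X (y ^ d) / coord l ^ d + y ^ d * cofactor l)"
    by (simp add: distrib_left mult_ac)
  finally have "cofactor j = X (y ^ d) / coord l ^ d + y ^ d * cofactor l"
    using F(2) by simp
  also have "X (y ^ d) = of_nat d * y ^ d' * X y"
    unfolding d' by (rule X_power[OF op y])
  finally have 2: "cofactor j = of_nat d * y ^ d' * X y / coord l ^ d + y ^ d * cofactor l" .
  have "coord j ^ d * y ^ d' / coord l ^ d = coord j / coord l"
    using nz by (simp add: y_def d' power_divide)
  moreover have "coord j ^ d * y ^ d = coord l ^ d" "coord j * y = coord l"
    using nz by (simp_all add: y_def power_divide)
  moreover have "lift j i = coord i * (coord j / coord l) * X y + coord j * y * X (coord i / coord l)
      - coord i * (coord j ^ d * y ^ d' / coord l ^ d) * X y - coord i * (coord j ^ d * y ^ d) * cofactor l / of_nat d"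
    unfolding lift_def 1 2 using of_nat_d_nonzero by (simp add: field_simps)
  ultimately show ?thesis
    unfolding lift_def by simp
qed

text \<open>By the chain rule the first part of the lift sends F to P F, and by Euler's formula the
  radial part, divided by d, sends F to the same multiple.\<close>

lemma lift_annihilates:
  assumes j: "j \<le> n"
  shows "(\<Sum>i\<le>n. to_fract (partial_deriv i F) * lift j i) = 0"
proof -
  obtain d' where d': "d = Suc d'"
    using d_nonzero by (cases d) auto
  have "(\<Sum>i\<le>n. to_fract (partial_deriv i F) * (coord j * X (coord i / coord j)))
      = coord j ^ d * (\<Sum>i\<le>n. to_fract (partial_deriv i F) / coord j ^ d' * X (coord i / coord j))"
    unfolding sum_distrib_left using coord_nonzero[of j] by (intro sum.cong) (simp_all add: d')
  also have "(\<Sum>i\<le>n. to_fract (partial_deriv i F) / coord j ^ d' * X (coord i / coord j))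
      = X (to_fract F / coord j ^ d)"
    using X_homog_ratio[OF F(1)[unfolded d'] j] by (simp only: d')
  also note X_equation
  finally have 1: "(\<Sum>i\<le>n. to_fract (partial_deriv i F) * (coord j * X (coord i / coord j)))
      = coord j ^ d * (to_fract F * cofactor j)" .
  have "(\<Sum>i\<le>n. to_fract (partial_deriv i F) * (coord i * coord j ^ d * cofactor j / of_nat d))
      = to_fract (\<Sum>i\<le>n. var i * partial_deriv i F) * (coord j ^ d * cofactor j / of_nat d)"
    unfolding to_fract_sum sum_distrib_right by (intro sum.cong) (simp_all add: mult_ac)
  also have "\<dots> = coord j ^ d * (to_fract F * cofactor j)"
    unfolding Euler_homog[OF F(1)] using of_nat_d_nonzero by (simp add: to_fract_of_nat)
  finally show ?thesis
    using 1 unfolding lift_def right_diff_distrib sum_subtractf by simp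
qed

text \<open>Since \<open>X 1 = 0\<close>, the component 0 in chart 0 consists of the radial
  correction alone. If it vanishes, so does \<open>cofactor 0\<close>, and then the other components
  are multiples of the \<open>X (coord i / coord 0)\<close>, which determine
  \<open>X\<close>.\<close>

lemma lift_nonzero:
  assumes "nonzero_vector_field n X"
  shows "\<exists>i\<le>n. lift 0 i \<noteq> 0"
proof (rule ccontr)
  assume "\<not> ?thesis"
  then have zero: "\<And>i. i \<le> n \<Longrightarrow> lift 0 i = 0"
    by blast
  have "X 1 = 0"
    using X_1[OF basic_open_var[of 0]] by simp
  then have "cofactor 0 = 0"
    using zero[of 0] of_nat_d_nonzero by (simp add: lift_def var_nonzero)
  then have "X (coord i / coord 0) = 0" if "i \<le> n" for i
    using zero[OF that] by (simp add: lift_def var_nonzero)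
  then show False
    using X_zero assms by blast
qed

text \<open>The assumption on \<open>n\<close> provides \<open>var 1\<close> as a second chart,
  where independence of the chart shows the same fraction to be a section.\<close>

lemma lift_polynomial:
  assumes "n \<noteq> 0" "i \<le> n"
  shows "\<exists>q\<in>homog n m. lift 0 i = to_fract q"
proof (rule section_extends)
  show "lift 0 i \<in> twist_sections n (int m) (var 0)"
    using assms by (intro lift_section) auto
  show "lift 0 i \<in> twist_sections n (int m) (var 1)"
    using assms lift_independent[of i 0 1] lift_section[of i 1] by simp
qed (use assms in auto)

end

section \<open>The degree bound\<close>

theorem theorem8:
  fixes X :: "'k::alg_closed_field mpoly fract \<Rightarrow> 'k mpoly fract"
    and F :: "'k mpoly"
    and n m d :: nat
  assumes "is_vector_field n m X"
    and "nonzero_vector_field n X"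
    and "is_hypersurface n d F"
    and "smooth_hypersurface n F"
    and "leaves_invariant n m X d F"
    and "\<not> CHAR('k) dvd d"
  shows "d \<le> m + 1"
proof -
  have F: "F \<in> homog n d" "F \<noteq> 0"
    using assms(3) by (auto simp: is_hypersurface_def)
  have d: "(of_nat d :: 'k) \<noteq> 0"
    using assms(6) by (simp add: of_nat_eq_0_iff_char_dvd)
  interpret invariant_hypersurface n m X d F
    by unfold_locales (rule assms(1) F assms(5) d)+
  obtain e where e: "d = Suc e"
    using d by (cases d) auto
  \<comment> \<open>On a point the only ratio of coordinates is 1, which every derivation
    kills.\<close>
  have "n \<noteq> 0"
  proof
    assume "n = 0"
    then have "X (coord i / coord 0) = 0" if "i \<le> n" for i
      using that X_1[OF basic_open_var[of 0]] by (simp add: var_nonzero)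
    then show False
      using X_zero assms(2) by blast
  qed
  then have "\<forall>i. \<exists>q. i \<le> n \<longrightarrow> q \<in> homog n m \<and> lift 0 i = to_fract q"
    using lift_polynomial by blast
  from choice[OF this] obtain G
    where G: "\<And>i. i \<le> n \<Longrightarrow> G i \<in> homog n m" "\<And>i. i \<le> n \<Longrightarrow> lift 0 i = to_fract (G i)"
    by blast
  obtain i where i: "i \<le> n" "G i \<noteq> 0"
    using lift_nonzero[OF assms(2)] G(2) by auto
  have "e \<le> m"
  proof (rule syzygy_degree_ge[where F = "\<lambda>i. partial_deriv i F" and G = G])
    show "partial_deriv i F \<in> homog n e" for i
      using F(1) unfolding e by (rule homog_partial_deriv)
    have "to_fract (\<Sum>i\<le>n. partial_deriv i F * G i) = 0"
      using lift_annihilates[of 0] by (simp add: to_fract_sum G(2))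
    then show "(\<Sum>i\<le>n. partial_deriv i F * G i) = 0"
      by (simp only: to_fract_eq_0_iff)
    show "\<exists>i\<le>n. eval_poly x (partial_deriv i F) \<noteq> 0" if x: "\<exists>i\<le>n. x i \<noteq> 0" for x
    proof (rule ccontr)
      assume zero: "\<not> ?thesis"
      note id_hom = refl refl refl refl
      note ev = subst_poly_sum[where \<phi> = "\<lambda>c :: 'k. c", OF id_hom]
        subst_poly_mult[where \<phi> = "\<lambda>c :: 'k. c", OF id_hom]
        subst_poly_of_nat[where \<phi> = "\<lambda>c :: 'k. c", OF id_hom]
      have "of_nat d * eval_poly x F = eval_poly x (of_nat d * F)"
        unfolding eval_poly_conv_subst ev ..
      also have "of_nat d * F = (\<Sum>i\<le>n. var i * partial_deriv i F)"
        by (rule Euler_homog[OF F(1), symmetric])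
      also have "eval_poly x \<dots> = 0"
        using zero unfolding eval_poly_conv_subst ev by simp
      finally have "eval_poly x F = 0"
        using d by simp
      then show False
        using assms(4) x zero unfolding smooth_hypersurface_def by blast
    qed
  qed (use i G(1) in auto)
  then show ?thesis
    by (simp add: e)
qed

end
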